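(* Let $(W,S)$ be a right-angled Coxeter system, i.e. $m_{ij}\in\{2,\infty\}$ for all $i\ne j$. Then $$H^{\mathfrak{Fin}}_i(W;\mathcal R)=H^{\mathfrak{Fin}(W)}_i(\Sigma;\mathcal R)\cong\begin{cases}\mathbb Z^{s}, & i=0,\\ 0, & i\neq 0,\end{cases}$$ where $s$ is the number of spherical subsets $T\subseteq S$, the empty set included.
   Context: Coxeter system: $(W,S)$ with $S=\{s_1,\dots,s_N\}$ finite and $W=\langle s_1,\dots,s_N\mid (s_is_j)^{m_{ij}}=1\rangle$, where $m_{ii}=1$ and $m_{ij}=m_{ji}\in\{2,3,\dots,\infty\}$ for $i\neq j$. $W_T=\langle T\rangle$ for $T\subseteq S$, and $T$ is spherical if $W_T$ is finite. $\Sigma$ is the Davis complex, the geometric realization of the poset of cosets $wW_T$ ($T$ spherical) ordered by inclusion, with $W$ acting by left multiplication. It is a model for the classifying space $\underline{E}W$ for proper actions, and $H^{\mathfrak{Fin}}_i(W;\mathcal R)$ denotes its Bredon homology. Bredon homology: for a $W$-CW-complex $X$ with finite stabilizers, choose orbit representatives $e_\alpha$ of the $d$-cells with stabilizers $S_\alpha$, set $C_d=\bigoplus_\alpha \mathcal R(W/S_\alpha)$, take the differentials induced by the cellular boundary, and take homology. $\mathcal R$ is the representation-ring Bredon module: $\mathcal R(W/K)=R_{\mathbb C}(K)$, the complex representation ring of the finite group $K$ viewed as an abelian group. A $W$-map $W/K\to W/L$, $K\mapsto gL$ (so $g^{-1}Kg\subseteq L$), goes to induction from $g^{-1}Kg$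 to $L$ after identifying $R_{\mathbb C}(g^{-1}Kg)\cong R_{\mathbb C}(K)$. *)

theory Defs
  imports Complex_Main "HOL-Algebra.Algebra" "HOL-Algebra.Free_Abelian_Groups"
    "HOL-Library.Extended_Nat"
begin

definition coxeter_matrix :: "nat \<Rightarrow> (nat \<Rightarrow> nat \<Rightarrow> enat) \<Rightarrow> bool" where
  "coxeter_matrix N m \<longleftrightarrow>
     (\<forall>i<N. m i i = 1) \<and> (\<forall>i<N. \<forall>j<N. m i j = m j i) \<and>
     (\<forall>i<N. \<forall>j<N. i \<noteq> j \<longrightarrow> m i j \<ge> 2)"

definition coxeter_relations ::
  "('h, 'c) monoid_scheme \<Rightarrow> nat \<Rightarrow> (nat \<Rightarrow> nat \<Rightarrow> enat) \<Rightarrow> (nat \<Rightarrow> 'h) \<Rightarrow> bool" where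
  "coxeter_relations H N m h \<longleftrightarrow>
     (\<forall>i<N. h i \<in> carrier H) \<and>
     (\<forall>i<N. \<forall>j<N. \<forall>k::nat. m i j = enat k \<longrightarrow> (h i \<otimes>\<^bsub>H\<^esub> h j) [^]\<^bsub>H\<^esub> k = \<one>\<^bsub>H\<^esub>)"

text \<open>(G, s) is (a model of) the Coxeter group given by the presentation
  < s_0..s_(N-1) | (s_i s_j)^(m i j) = 1 >: G is a group generated by the s_i, the s_i satisfy
  the relations, and G has the universal property of the presentation: for every group H
  and elements satisfying the relations there is a homomorphism G -> H sending s_i to h_i.
  It suffices to test the universal property on groups with carrier in nat, since every
  group generated by N elements is countable.\<close>
definition coxeter_system ::
  "('g, 'b) monoid_scheme \<Rightarrow> nat \<Rightarrow> (nat \<Rightarrow> nat \<Rightarrow> enat) \<Rightarrow> (nat \<Rightarrow> 'g) \<Rightarrow> bool" where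
  "coxeter_system G N m s \<longleftrightarrow>
     group G \<and> coxeter_matrix N m \<and> coxeter_relations G N m s \<and>
     generate G (s ` {..<N}) = carrier G \<and>
     (\<forall>(H :: nat monoid) h. group H \<longrightarrow> coxeter_relations H N m h \<longrightarrow>
        (\<exists>\<phi> \<in> hom G H. \<forall>i<N. \<phi> (s i) = h i))"

definition right_angled :: "nat \<Rightarrow> (nat \<Rightarrow> nat \<Rightarrow> enat) \<Rightarrow> bool" where
  "right_angled N m \<longleftrightarrow> (\<forall>i<N. \<forall>j<N. i \<noteq> j \<longrightarrow> m i j = 2 \<or> m i j = \<infinity>)"

definition special_subgroup :: "('g, 'b) monoid_scheme \<Rightarrow> (nat \<Rightarrow> 'g) \<Rightarrow> nat set \<Rightarrow> 'g set" where
  "special_subgroup G s T = generate G (s ` T)"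

definition spherical :: "('g, 'b) monoid_scheme \<Rightarrow> nat \<Rightarrow> (nat \<Rightarrow> 'g) \<Rightarrow> nat set \<Rightarrow> bool" where
  "spherical G N s T \<longleftrightarrow> T \<subseteq> {..<N} \<and> finite (special_subgroup G s T)"

text \<open>Vertices: cosets w W_T with T spherical.  The Davis complex is the geometric
  realization of this poset (ordered by inclusion); its d-cells are the d-simplices, i.e.
  strictly increasing chains c_0 < c_1 < ... < c_d of such cosets (listed increasingly).\<close>
definition davis_vertices :: "('g, 'b) monoid_scheme \<Rightarrow> nat \<Rightarrow> (nat \<Rightarrow> 'g) \<Rightarrow> 'g set set" where
  "davis_vertices G N s =
     {w <#\<^bsub>G\<^esub> special_subgroup G s T | w T. w \<in> carrier G \<and> spherical G N s T}"

definition davis_cells ::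
  "('g, 'b) monoid_scheme \<Rightarrow> nat \<Rightarrow> (nat \<Rightarrow> 'g) \<Rightarrow> nat \<Rightarrow> 'g set list set" where
  "davis_cells G N s d =
     {\<sigma>. length \<sigma> = Suc d \<and> set \<sigma> \<subseteq> davis_vertices G N s \<and> sorted_wrt (\<subset>) \<sigma>}"

definition cell_act :: "('g, 'b) monoid_scheme \<Rightarrow> 'g \<Rightarrow> 'g set list \<Rightarrow> 'g set list" where
  "cell_act G g \<sigma> = map (\<lambda>c. g <#\<^bsub>G\<^esub> c) \<sigma>"

definition cell_stab :: "('g, 'b) monoid_scheme \<Rightarrow> 'g set list \<Rightarrow> 'g set" where
  "cell_stab G \<sigma> = {g \<in> carrier G. cell_act G g \<sigma> = \<sigma>}"

definition cell_orbit :: "('g, 'b) monoid_scheme \<Rightarrow> 'g set list \<Rightarrow> 'g set list set" where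
  "cell_orbit G \<sigma> = {cell_act G g \<sigma> | g. g \<in> carrier G}"

definition cell_reps ::
  "('g, 'b) monoid_scheme \<Rightarrow> nat \<Rightarrow> (nat \<Rightarrow> 'g) \<Rightarrow> nat \<Rightarrow> 'g set list set" where
  "cell_reps G N s d =
     (\<lambda>Orb. SOME \<tau>. \<tau> \<in> Orb) ` {cell_orbit G \<sigma> | \<sigma>. \<sigma> \<in> davis_cells G N s d}"

definition cell_face :: "nat \<Rightarrow> 'a list \<Rightarrow> 'a list" where
  "cell_face j \<sigma> = take j \<sigma> @ drop (Suc j) \<sigma>"

text \<open>A complex representation of the subgroup K of G of dimension n: matrices are given as
  functions nat => nat => complex, only the entries with indices < n being relevant.\<close>
definition is_representation ::
  "('g, 'b) monoid_scheme \<Rightarrow> 'g set \<Rightarrow> nat \<Rightarrow> ('g \<Rightarrow> nat \<Rightarrow> nat \<Rightarrow> complex) \<Rightarrow> bool" where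
  "is_representation G K n \<rho> \<longleftrightarrow>
     (\<forall>i<n. \<forall>j<n. \<rho> \<one>\<^bsub>G\<^esub> i j = (if i = j then 1 else 0)) \<and>
     (\<forall>x\<in>K. \<forall>y\<in>K. \<forall>i<n. \<forall>j<n. \<rho> (x \<otimes>\<^bsub>G\<^esub> y) i j = (\<Sum>k<n. \<rho> x i k * \<rho> y k j))"

definition rep_character ::
  "'g set \<Rightarrow> nat \<Rightarrow> ('g \<Rightarrow> nat \<Rightarrow> nat \<Rightarrow> complex) \<Rightarrow> 'g \<Rightarrow> complex" where
  "rep_character K n \<rho> = (\<lambda>x. if x \<in> K then (\<Sum>i<n. \<rho> x i i) else 0)"

text \<open>R_C(K), realized (via characters) as the abelian group of virtual characters of K,
  i.e. differences of characters of representations, as functions vanishing off K.\<close>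
definition rep_ring :: "('g, 'b) monoid_scheme \<Rightarrow> 'g set \<Rightarrow> ('g \<Rightarrow> complex) set" where
  "rep_ring G K =
     {\<chi>. \<exists>n1 \<rho>1 n2 \<rho>2. is_representation G K n1 \<rho>1 \<and> is_representation G K n2 \<rho>2 \<and>
          \<chi> = (\<lambda>x. rep_character K n1 \<rho>1 x - rep_character K n2 \<rho>2 x)}"

definition induce ::
  "('g, 'b) monoid_scheme \<Rightarrow> 'g set \<Rightarrow> 'g set \<Rightarrow> ('g \<Rightarrow> complex) \<Rightarrow> 'g \<Rightarrow> complex" where
  "induce G H L \<phi> = (\<lambda>x. if x \<in> L then
      (\<Sum>y\<in>L. if inv\<^bsub>G\<^esub> y \<otimes>\<^bsub>G\<^esub> x \<otimes>\<^bsub>G\<^esub> y \<in> H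
               then \<phi> (inv\<^bsub>G\<^esub> y \<otimes>\<^bsub>G\<^esub> x \<otimes>\<^bsub>G\<^esub> y) else 0) / of_nat (card H)
      else 0)"

text \<open>The map R(K) -> R(L) attached to the W-map W/K -> W/L, K |-> gL (g^-1 K g <= L):
  identify R(K) with R(g^-1 K g) by conjugation, then induce to L.\<close>
definition bredon_map ::
  "('g, 'b) monoid_scheme \<Rightarrow> 'g \<Rightarrow> 'g set \<Rightarrow> 'g set \<Rightarrow> ('g \<Rightarrow> complex) \<Rightarrow> 'g \<Rightarrow> complex" where
  "bredon_map G g K L \<phi> =
     induce G ((\<lambda>k. inv\<^bsub>G\<^esub> g \<otimes>\<^bsub>G\<^esub> k \<otimes>\<^bsub>G\<^esub> g) ` K) L
       (\<lambda>x. \<phi> (g \<otimes>\<^bsub>G\<^esub> x \<otimes>\<^bsub>G\<^esub> inv\<^bsub>G\<^esub> g))"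

definition bredon_chains ::
  "('g, 'b) monoid_scheme \<Rightarrow> nat \<Rightarrow> (nat \<Rightarrow> 'g) \<Rightarrow> nat \<Rightarrow> ('g set list \<Rightarrow> 'g \<Rightarrow> complex) set" where
  "bredon_chains G N s d =
     {c. (\<forall>\<sigma>\<in>cell_reps G N s d. c \<sigma> \<in> rep_ring G (cell_stab G \<sigma>)) \<and>
         (\<forall>\<sigma>. \<sigma> \<notin> cell_reps G N s d \<longrightarrow> c \<sigma> = (\<lambda>_. 0))}"

definition bredon_chain_group ::
  "('g, 'b) monoid_scheme \<Rightarrow> nat \<Rightarrow> (nat \<Rightarrow> 'g) \<Rightarrow> nat \<Rightarrow> ('g set list \<Rightarrow> 'g \<Rightarrow> complex) monoid" where
  "bredon_chain_group G N s d =
     \<lparr>carrier = bredon_chains G N s d, monoid.mult = (\<lambda>a b. \<lambda>\<sigma> x. a \<sigma> x + b \<sigma> x),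
      one = (\<lambda>_ _. 0)\<rparr>"

text \<open>Differential C_(d+1) -> C_d induced by the simplicial boundary
  sum_j (-1)^j face_j: if face_j(sigma) = g . tau with tau a representative, the summand
  uses the W-map W/Stab(sigma) -> W/Stab(tau), Stab(sigma) |-> g Stab(tau).\<close>
definition bredon_boundary ::
  "('g, 'b) monoid_scheme \<Rightarrow> nat \<Rightarrow> (nat \<Rightarrow> 'g) \<Rightarrow> nat \<Rightarrow>
     ('g set list \<Rightarrow> 'g \<Rightarrow> complex) \<Rightarrow> ('g set list \<Rightarrow> 'g \<Rightarrow> complex)" where
  "bredon_boundary G N s d c = (\<lambda>\<tau> x.
     if \<tau> \<in> cell_reps G N s d then
       (\<Sum>\<sigma>\<in>cell_reps G N s (Suc d). \<Sum>j\<le>Suc d.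
          if cell_face j \<sigma> \<in> cell_orbit G \<tau> then
            (-1) ^ j * bredon_map G
                        (SOME g. g \<in> carrier G \<and> cell_act G g \<tau> = cell_face j \<sigma>)
                        (cell_stab G \<sigma>) (cell_stab G \<tau>) (c \<sigma>) x
          else 0)
     else 0)"

definition bredon_cycles ::
  "('g, 'b) monoid_scheme \<Rightarrow> nat \<Rightarrow> (nat \<Rightarrow> 'g) \<Rightarrow> nat \<Rightarrow> ('g set list \<Rightarrow> 'g \<Rightarrow> complex) set" where
  "bredon_cycles G N s i =
     (if i = 0 then bredon_chains G N s 0
      else {c \<in> bredon_chains G N s i. bredon_boundary G N s (i - 1) c = (\<lambda>_ _. 0)})"

definition bredon_boundaries ::
  "('g, 'b) monoid_scheme \<Rightarrow> nat \<Rightarrow> (nat \<Rightarrow> 'g) \<Rightarrow> nat \<Rightarrow> ('g set list \<Rightarrow> 'g \<Rightarrow> complex) set" where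
  "bredon_boundaries G N s i = bredon_boundary G N s i ` bredon_chains G N s (Suc i)"

definition bredon_homology ::
  "('g, 'b) monoid_scheme \<Rightarrow> nat \<Rightarrow> (nat \<Rightarrow> 'g) \<Rightarrow> nat \<Rightarrow> ('g set list \<Rightarrow> 'g \<Rightarrow> complex) set monoid" where
  "bredon_homology G N s i =
     ((bredon_chain_group G N s i)\<lparr>carrier := bredon_cycles G N s i\<rparr>) Mod bredon_boundaries G N s i"

end

theory Submission
  imports Defs "Jordan_Normal_Form.Schur_Decomposition"
begin

text \<open>
  Every cell of the Davis complex is a translate of a unique flag \<open>W\<^sub>T\<^sub>0 \<subset> \<dots> \<subset> W\<^sub>T\<^sub>d\<close> of
  spherical special subgroups, and its stabilizer is a conjugate of \<open>W\<^sub>T\<^sub>0\<close>. In the right-angled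
  case \<open>W\<^sub>T\<close> is \<open>(\<int>/2)\<^sup>T\<close>, whose representation ring has as a basis the representations
  \<open>e\<^sub>T\<^sub>,\<^sub>U\<close> induced from the trivial representations of the subgroups \<open>W\<^sub>U\<close>, \<open>U \<subseteq> T\<close>.
  Induction sends \<open>e\<^sub>T\<^sub>,\<^sub>U\<close> to \<open>e\<^sub>T\<^sub>'\<^sub>,\<^sub>U\<close>, so the Bredon complex splits as the direct sum, over
  the spherical sets \<open>U\<close>, of the simplicial chain complexes of the posets of spherical sets
  containing \<open>U\<close>. Each of these is a cone with apex \<open>U\<close> and contributes a single \<open>\<int>\<close> in degree \<open>0\<close>.
\<close>

section \<open>Chains of flags\<close>

text \<open>The sign characters, the obvious basis of the representation ring of W_T, do not serve
  here: inducing one of them to W_T' gives a sum of 2^|T' - T| sign characters, so the differential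
  would mix basis elements and hide the splitting. The induced trivial characters are also a
  Z-basis, because e_(T,U) is the sum of the sign characters indexed by the subsets of T - U, and
  Moebius inversion on subsets has integer coefficients. For them transitivity of induction makes
  every coefficient 1 and keeps U fixed.

  That virtual characters have integer coordinates at all comes from the fact that idempotent
  complex matrices have integer trace.

  The cone argument is carried out for the augmented complex. Exactness at flags with one vertex
  then identifies the boundaries in degree 0 with the kernel of the augmentation, and H_0 is the
  image of the augmentation.\<close>

definition alt_face_sum :: "('a list \<Rightarrow> int) \<Rightarrow> 'a list \<Rightarrow> int" where
  "alt_face_sum f F = (\<Sum>j<length F. (-1) ^ j * f (cell_face j F))"

text \<open>Indexed by the number of vertices, so that degree \<open>d\<close> corresponds to \<open>n = Suc d\<close> and
  the boundary out of \<open>n = 1\<close> is the augmentation.\<close>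

definition flags :: "'a set set \<Rightarrow> nat \<Rightarrow> 'a set list set" where
  "flags P n = {F. length F = n \<and> set F \<subseteq> P \<and> sorted_wrt (\<subset>) F}"

text \<open>\<open>a F U\<close> is the coefficient of e_(T,U) at the flag F, where T =
  \<open>hd F\<close> is the type of the stabilizer; hence U \<subseteq> \<open>hd F\<close>. All
  summands U of the complex are treated at once.\<close>

definition flag_chains :: "'a set set \<Rightarrow> nat \<Rightarrow> ('a set list \<Rightarrow> 'a set \<Rightarrow> int) set" where
  "flag_chains P n = {a. \<forall>F U. a F U \<noteq> 0 \<longrightarrow> F \<in> flags P n \<and> U \<subseteq> hd F}"

definition flag_boundary ::
  "'a set set \<Rightarrow> nat \<Rightarrow> ('a set list \<Rightarrow> 'a set \<Rightarrow> int) \<Rightarrow> 'a set list \<Rightarrow> 'a set \<Rightarrow> int" where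
  "flag_boundary P n a = (\<lambda>E U. \<Sum>F\<in>flags P n. a F U * alt_face_sum (\<lambda>H. of_bool (H = E)) F)"

lemma cell_face_Cons [simp]:
  "cell_face 0 (x # F) = F" "cell_face (Suc j) (x # F) = x # cell_face j F"
  by (simp_all add: cell_face_def)

lemma alt_face_sum_Nil [simp]: "alt_face_sum f [] = 0"
  by (simp add: alt_face_sum_def)

text \<open>Deleting x gives F; every other deletion keeps x and shifts the index by one, hence the
  minus sign. Both d^2 = 0 and the cone homotopy are computed with this recursion.\<close>

lemma alt_face_sum_Cons:
  "alt_face_sum f (x # F) = f F - alt_face_sum (\<lambda>H. f (x # H)) F"
  by (simp add: alt_face_sum_def sum.lessThan_Suc_shift sum_negf del: sum.lessThan_Suc)

lemma alt_face_sum_diff: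
  "alt_face_sum (\<lambda>H. f H - g H) F = alt_face_sum f F - alt_face_sum g F"
  by (simp add: alt_face_sum_def right_diff_distrib sum_subtractf)

lemma alt_face_sum_zero [simp]: "alt_face_sum (\<lambda>H. 0) F = 0"
  by (simp add: alt_face_sum_def)

text \<open>The induction needs arbitrary f, as it is applied to
  \<open>\<lambda>H. f (x # H)\<close>: unfolding the recursion twice, the terms
  \<open>alt_face_sum f F\<close> cancel and a double sum over F remains.\<close>

lemma alt_face_sum_alt_face_sum: "alt_face_sum (alt_face_sum f) F = 0"
  by (induction F arbitrary: f) (simp_all add: alt_face_sum_Cons alt_face_sum_diff)

lemma length_cell_face: "j < length F \<Longrightarrow> length (cell_face j F) = length F - 1"
  by (simp add: cell_face_def)

lemma set_cell_face: "set (cell_face j F) \<subseteq> set F"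
  by (auto simp: cell_face_def dest: in_set_takeD in_set_dropD)

lemma sorted_wrt_cell_face: "sorted_wrt R F \<Longrightarrow> sorted_wrt R (cell_face j F)"
proof -
  assume "sorted_wrt R F"
  moreover have "F = take j F @ drop j F" by simp
  ultimately have "sorted_wrt R (take j F @ drop j F)" by simp
  moreover have "drop (Suc j) F = drop 1 (drop j F)" by simp
  moreover have "sorted_wrt R (drop 1 (drop j F))"
    using \<open>sorted_wrt R F\<close> by (intro sorted_wrt_drop)
  ultimately show ?thesis
    unfolding cell_face_def sorted_wrt_append by (metis in_set_dropD)
qed

lemma cell_face_in_flags:
  "F \<in> flags P (Suc n) \<Longrightarrow> j \<le> n \<Longrightarrow> cell_face j F \<in> flags P n"
  using set_cell_face[of j F]
  by (auto simp: flags_def length_cell_face intro: sorted_wrt_cell_face)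

lemma finite_flags: "finite P \<Longrightarrow> finite (flags P n)"
  by (rule finite_subset[OF _ finite_lists_length_eq[of P n]]) (auto simp: flags_def)

lemma Cons_in_flags:
  assumes "n \<noteq> 0"
  shows "T # F \<in> flags P (Suc n) \<longleftrightarrow> T \<in> P \<and> F \<in> flags P n \<and> T \<subset> hd F"
proof (cases F)
  case Nil
  then show ?thesis using assms by (simp add: flags_def)
next
  case (Cons T' F')
  then show ?thesis by (auto simp: flags_def)
qed

text \<open>Only deleting the first vertex changes the head, and it makes the head larger. So a set
  U admissible for a flag stays admissible for its faces.\<close>

lemma hd_subset_hd_cell_face:
  assumes "F \<in> flags P (Suc n)" "n \<noteq> 0" "j \<le> n"
  shows "hd F \<subseteq> hd (cell_face j F)"
proof -
  obtain T F' where F: "F = T # F'" using assms(1) by (cases F) (auto simp: flags_def)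
  show ?thesis
  proof (cases j)
    case 0
    then show ?thesis using assms F by (auto simp: Cons_in_flags)
  qed (use F in simp)
qed

lemma flag_boundary_in_flag_chains:
  assumes "a \<in> flag_chains P (Suc n)" "n \<noteq> 0"
  shows "flag_boundary P (Suc n) a \<in> flag_chains P n"
  unfolding flag_chains_def
proof (safe)
  fix E U assume nz: "flag_boundary P (Suc n) a E U \<noteq> 0"
  then obtain F where F: "F \<in> flags P (Suc n)" "a F U \<noteq> 0"
    "alt_face_sum (\<lambda>H. of_bool (H = E)) F \<noteq> 0"
    unfolding flag_boundary_def by (metis (no_types, lifting) mult_eq_0_iff sum.not_neutral_contains_not_neutral)
  have "\<exists>j<length F. cell_face j F = E"
  proof (rule ccontr)
    assume "\<not> ?thesis"
    then have "alt_face_sum (\<lambda>H. of_bool (H = E)) F = 0"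
      unfolding alt_face_sum_def by (intro sum.neutral) auto
    with F(3) show False by simp
  qed
  then obtain j where j: "j < length F" "cell_face j F = E" by blast
  then have jn: "j \<le> n" using F by (auto simp: flags_def)
  show "E \<in> flags P n" using cell_face_in_flags[OF F(1) jn] j by simp
  have "U \<subseteq> hd F" using assms(1) F(2) by (auto simp: flag_chains_def)
  then show "x \<in> hd E" if "x \<in> U" for x
    using hd_subset_hd_cell_face[OF F(1) assms(2) jn] j that by auto
qed

lemma flag_boundary_flag_boundary:
  assumes "finite P"
  shows "flag_boundary P n (flag_boundary P (Suc n) a) = (\<lambda>_ _. 0)"
proof (intro ext)
  fix E U
  let ?\<delta> = "\<lambda>E H. of_bool (H = E) :: int"
  have "flag_boundary P n (flag_boundary P (Suc n) a) E U =
    (\<Sum>F\<in>flags P (Suc n). a F U *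
       (\<Sum>H\<in>flags P n. alt_face_sum (?\<delta> H) F * alt_face_sum (?\<delta> E) H))"
    unfolding flag_boundary_def sum_distrib_right sum_distrib_left
    by (subst sum.swap) (simp add: mult.assoc)
  \<comment> \<open>The sum over H only picks out the faces of F, so the double boundary becomes an
    iterated alternating sum on one flag.\<close>
  also have "\<dots> = (\<Sum>F\<in>flags P (Suc n). a F U * alt_face_sum (alt_face_sum (?\<delta> E)) F)"
  proof (intro sum.cong refl arg_cong2[where f = "(*)"])
    fix F assume F: "F \<in> flags P (Suc n)"
    then have len: "length F = Suc n" by (simp add: flags_def)
    have "(\<Sum>H\<in>flags P n. alt_face_sum (?\<delta> H) F * alt_face_sum (?\<delta> E) H) =
      (\<Sum>j<length F. \<Sum>H\<in>flags P n. (-1) ^ j * (if H = cell_face j F then alt_face_sum (?\<delta> E) H else 0))"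
      unfolding alt_face_sum_def[of _ F] sum_distrib_right
      by (subst sum.swap) (auto intro!: sum.cong)
    also have "\<dots> = alt_face_sum (alt_face_sum (?\<delta> E)) F"
      unfolding alt_face_sum_def[of _ F] sum_distrib_left[symmetric]
      using cell_face_in_flags[OF F] len
      by (intro sum.cong refl) (simp add: sum.delta finite_flags[OF assms])
    finally show "(\<Sum>H\<in>flags P n. alt_face_sum (?\<delta> H) F * alt_face_sum (?\<delta> E) H) = \<dots>" .
  qed
  finally show "flag_boundary P n (flag_boundary P (Suc n) a) E U = 0"
    by (simp add: alt_face_sum_alt_face_sum)
qed

text \<open>For fixed \<open>U\<close> the flags of sets containing \<open>U\<close> form a cone with apex \<open>U\<close>, and
  prepending \<open>U\<close> is the contracting homotopy.\<close>

lemma flag_chains_exact: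
  assumes fin: "finite P" and down: "\<And>T U. T \<in> P \<Longrightarrow> U \<subseteq> T \<Longrightarrow> U \<in> P"
    and n: "n \<noteq> 0" and z: "z \<in> flag_chains P n" and cyc: "flag_boundary P n z = (\<lambda>_ _. 0)"
  shows "\<exists>b\<in>flag_chains P (Suc n). flag_boundary P (Suc n) b = z"
proof
  let ?\<delta> = "\<lambda>E H. of_bool (H = E) :: int"
  \<comment> \<open>A flag that already begins with U would become degenerate; membership in
    \<open>flags\<close> discards it.\<close>
  define b where "b = (\<lambda>F U. if F \<in> flags P (Suc n) \<and> hd F = U then z (tl F) U else 0)"
  show b: "b \<in> flag_chains P (Suc n)"
    by (auto simp: flag_chains_def b_def)
  show "flag_boundary P (Suc n) b = z"
  proof (intro ext)
    fix E U
    show "flag_boundary P (Suc n) b E U = z E U"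
    proof (cases "E \<in> flags P n \<and> U \<subseteq> hd E")
      case False
      then have "flag_boundary P (Suc n) b E U = 0" "z E U = 0"
        using flag_boundary_in_flag_chains[OF b n] z unfolding flag_chains_def by blast+
      then show ?thesis by simp
    next
      case True
      then have E: "E \<in> flags P n" and U: "U \<subseteq> hd E" by auto
      obtain T E' where E': "E = T # E'" using E n by (cases E) (auto simp: flags_def)
      have UP: "U \<in> P" using E U E' down by (auto simp: flags_def)
      \<comment> \<open>J consists of the flags that stay strict when U is prepended; only
        \<open>U # F\<close> with F in J contributes to the boundary of b.\<close>
      define J where "J = {F \<in> flags P n. U \<subset> hd F}"
      have finJ: "finite J" using finite_flags[OF fin, of n] by (simp add: J_def)
      have "flag_boundary P (Suc n) b E U =
        (\<Sum>F\<in>(#) U ` J. b F U * alt_face_sum (?\<delta> E) F)"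
        unfolding flag_boundary_def
      proof (rule sum.mono_neutral_right[OF finite_flags[OF fin]])
        show "(#) U ` J \<subseteq> flags P (Suc n)" using UP n by (auto simp: J_def Cons_in_flags)
        show "\<forall>F\<in>flags P (Suc n) - (#) U ` J. b F U * alt_face_sum (?\<delta> E) F = 0"
        proof
          fix F assume F: "F \<in> flags P (Suc n) - (#) U ` J"
          obtain T F' where "F = T # F'" using F by (cases F) (auto simp: flags_def)
          then show "b F U * alt_face_sum (?\<delta> E) F = 0"
            using F n by (auto simp: b_def J_def Cons_in_flags)
        qed
      qed
      also have "\<dots> = (\<Sum>F\<in>J. z F U * alt_face_sum (?\<delta> E) (U # F))"
        using UP n by (subst sum.reindex) (auto simp: b_def J_def Cons_in_flags intro!: sum.cong)
      also have "\<dots> = (\<Sum>F\<in>J. z F U * of_bool (F = E)) - (\<Sum>F\<in>J. z F U * alt_face_sum (\<lambda>H. of_bool (U # H = E)) F)"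
        by (simp add: alt_face_sum_Cons algebra_simps sum_subtractf)
      also have "\<dots> = z E U"
      \<comment> \<open>If E does not begin with U, it arises only by dropping the new vertex U. If
        it does, it arises only from faces that keep U, and the cycle condition at the remainder
        \<open>E'\<close> gives the value.\<close>
      proof (cases "T = U")
        case False
        then have "E \<in> J" using E U E' by (auto simp: J_def)
        moreover have "alt_face_sum (\<lambda>H. of_bool (U # H = E)) F = 0" for F
          using False E' by simp
        ultimately show ?thesis using finJ by (simp add: of_bool_def if_distrib cong: if_cong)
      next
        case True
        have EJ: "E \<notin> J" using E' True by (auto simp: J_def)
        have "alt_face_sum (\<lambda>H. of_bool (U # H = E)) F = alt_face_sum (?\<delta> E') F" for F
          using E' True by simp
        moreover have "(\<Sum>F\<in>J. z F U * alt_face_sum (?\<delta> E') F) = - z E U"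
        proof -
          have "0 = (\<Sum>F\<in>flags P n. z F U * alt_face_sum (?\<delta> E') F)"
            using fun_cong[OF fun_cong[OF cyc, of E'], of U] by (simp add: flag_boundary_def)
          \<comment> \<open>Other flags beginning with U keep U in every face but the first, and
            \<open>E'\<close> does not begin with U. Flags whose head does not contain U carry no
            coefficient.\<close>
          also have "\<dots> = (\<Sum>F\<in>insert E J. z F U * alt_face_sum (?\<delta> E') F)"
          proof (rule sum.mono_neutral_right[OF finite_flags[OF fin]])
            show "insert E J \<subseteq> flags P n" using E by (auto simp: J_def)
            show "\<forall>F\<in>flags P n - insert E J. z F U * alt_face_sum (?\<delta> E') F = 0"
            proof
              fix F assume F: "F \<in> flags P n - insert E J"
              obtain T' F' where F': "F = T' # F'" using F n by (cases F) (auto simp: flags_def)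
              show "z F U * alt_face_sum (?\<delta> E') F = 0"
              proof (cases "T' = U")
                case True
                then have ne: "F' \<noteq> E'" using F F' E' \<open>T = U\<close> by auto
                have "U # H \<noteq> E'" for H
                proof
                  assume "U # H = E'"
                  then have "sorted_wrt (\<subset>) (U # U # H)"
                    using E E' \<open>T = U\<close> by (simp add: flags_def)
                  then show False by simp
                qed
                then show ?thesis using ne F' True by (simp add: alt_face_sum_Cons)
              next
                case False
                then have "\<not> U \<subseteq> hd F" using F F' by (auto simp: J_def)
                then have "z F U = 0" using z by (auto simp: flag_chains_def)
                then show ?thesis by simp
              qed
            qed
          qed
          also have "\<dots> = z E U * alt_face_sum (?\<delta> E') E + (\<Sum>F\<in>J. z F U * alt_face_sum (?\<delta> E') F)"
            using EJ finJ by simp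
          also have "alt_face_sum (?\<delta> E') E = 1"
          proof -
            have "T # H \<noteq> E'" for H
            proof
              assume "T # H = E'"
              then have "sorted_wrt (\<subset>) (T # T # H)"
                using E E' by (simp add: flags_def)
              then show False by simp
            qed
            then show ?thesis using E' by (simp add: alt_face_sum_Cons)
          qed
          finally show ?thesis by simp
        qed
        moreover have "(\<Sum>F\<in>J. z F U * of_bool (F = E)) = 0"
          using EJ by (intro sum.neutral) auto
        ultimately show ?thesis by simp
      qed
      finally show ?thesis .
    qed
  qed
qed

lemma map_in_flags:
  assumes "\<sigma> \<in> flags P n" "\<And>c. c \<in> P \<Longrightarrow> f c \<in> Q"
    and "\<And>c c'. c \<in> P \<Longrightarrow> c' \<in> P \<Longrightarrow> c \<subset> c' \<Longrightarrow> f c \<subset> f c'"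
  shows "map f \<sigma> \<in> flags Q n"
proof -
  have \<sigma>: "sorted_wrt (\<subset>) \<sigma>" "set \<sigma> \<subseteq> P" using assms(1) by (auto simp: flags_def)
  have "sorted_wrt (\<lambda>x y. f x \<subset> f y) \<sigma>"
  proof (rule sorted_wrt_mono_rel[OF _ \<sigma>(1)])
    fix c c' assume "c \<in> set \<sigma>" "c' \<in> set \<sigma>" "c \<subset> c'"
    then show "f c \<subset> f c'" using \<sigma>(2) by (intro assms(3)) auto
  qed
  then show ?thesis using assms(1,2) by (auto simp: flags_def sorted_wrt_map)
qed

lemma cell_face_map: "map f (cell_face j F) = cell_face j (map f F)"
  by (simp add: cell_face_def take_map drop_map)

definition flag_cycles :: "'a set set \<Rightarrow> nat \<Rightarrow> ('a set list \<Rightarrow> 'a set \<Rightarrow> int) set" where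
  "flag_cycles P n = {a \<in> flag_chains P n. flag_boundary P n a = (\<lambda>_ _. 0)}"

text \<open>Exactness in the form used for homology. It includes n = 1, where
  \<open>flag_cycles\<close> is the kernel of the augmentation.\<close>

lemma flag_boundary_image:
  assumes "finite P" "\<And>T U. T \<in> P \<Longrightarrow> U \<subseteq> T \<Longrightarrow> U \<in> P" "n \<noteq> 0"
  shows "flag_boundary P (Suc n) ` flag_chains P (Suc n) = flag_cycles P n"
proof
  show "flag_boundary P (Suc n) ` flag_chains P (Suc n) \<subseteq> flag_cycles P n"
    using flag_boundary_in_flag_chains[OF _ assms(3)] flag_boundary_flag_boundary[OF assms(1)]
    by (auto simp: flag_cycles_def)
  show "flag_cycles P n \<subseteq> flag_boundary P (Suc n) ` flag_chains P (Suc n)"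
  proof
    fix z assume "z \<in> flag_cycles P n"
    then have z: "z \<in> flag_chains P n" "flag_boundary P n z = (\<lambda>_ _. 0)"
      by (auto simp: flag_cycles_def)
    have "\<exists>b\<in>flag_chains P (Suc n). flag_boundary P (Suc n) b = z"
      by (rule flag_chains_exact[OF assms z])
    then show "z \<in> flag_boundary P (Suc n) ` flag_chains P (Suc n)" by auto
  qed
qed

lemma flag_boundary_one:
  "flag_boundary P (Suc 0) a E U = (if E = [] then (\<Sum>T\<in>P. a [T] U) else 0)"
proof -
  have "flags P (Suc 0) = (\<lambda>T. [T]) ` P"
    by (auto simp: flags_def length_Suc_conv)
  then have "flag_boundary P (Suc 0) a E U = (\<Sum>T\<in>P. a [T] U * of_bool ([] = E))"
    unfolding flag_boundary_def by (simp add: sum.reindex inj_on_def alt_face_sum_Cons)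
  then show ?thesis by auto
qed

definition additively_closed :: "('x \<Rightarrow> 'y \<Rightarrow> 'z :: ab_group_add) set \<Rightarrow> bool" where
  "additively_closed A \<longleftrightarrow> (\<lambda>_ _. 0) \<in> A \<and> (\<forall>a\<in>A. \<forall>b\<in>A. (\<lambda>x y. a x y + b x y) \<in> A) \<and>
     (\<forall>a\<in>A. (\<lambda>x y. - a x y) \<in> A)"

lemma additively_closed_flag_chains: "additively_closed (flag_chains P n)"
  unfolding additively_closed_def
proof (intro conjI ballI)
  fix a b assume ab: "a \<in> flag_chains P n" "b \<in> flag_chains P n"
  have "F \<in> flags P n \<and> U \<subseteq> hd F" if "a F U + b F U \<noteq> 0" for F U
  proof -
    have "a F U \<noteq> 0 \<or> b F U \<noteq> 0" using that by auto
    then show ?thesis using ab unfolding flag_chains_def by blast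
  qed
  then show "(\<lambda>x y. a x y + b x y) \<in> flag_chains P n" by (simp add: flag_chains_def)
qed (auto simp: flag_chains_def)

lemma flag_boundary_add:
  "flag_boundary P n (\<lambda>F U. a F U + b F U) E U = flag_boundary P n a E U + flag_boundary P n b E U"
  by (simp add: flag_boundary_def distrib_right sum.distrib)

lemma flag_boundary_uminus:
  "flag_boundary P n (\<lambda>F U. - a F U) E U = - flag_boundary P n a E U"
  by (simp add: flag_boundary_def sum_negf)

lemma flag_boundary_zero: "flag_boundary P n (\<lambda>F U. 0) = (\<lambda>_ _. 0)"
  by (simp add: flag_boundary_def)

lemma additively_closed_flag_cycles: "additively_closed (flag_cycles P n)"
  using additively_closed_flag_chains[of P n]
  unfolding additively_closed_def flag_cycles_def
  by (auto simp: flag_boundary_add flag_boundary_uminus flag_boundary_zero fun_eq_iff)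

section \<open>Representation rings of elementary abelian 2-groups\<close>

lemma trace_mult_commute:
  fixes A B :: "'a :: comm_semiring_1 mat"
  assumes "A \<in> carrier_mat n n" "B \<in> carrier_mat n n"
  shows "(\<Sum>i<n. (A * B) $$ (i, i)) = (\<Sum>i<n. (B * A) $$ (i, i))"
proof -
  have *: "(\<Sum>i<n. (A * B) $$ (i, i)) = (\<Sum>i<n. \<Sum>k<n. A $$ (i, k) * B $$ (k, i))"
    if "A \<in> carrier_mat n n" "B \<in> carrier_mat n n" for A B :: "'a mat"
    using that by (intro sum.cong refl) (auto simp: scalar_prod_def lessThan_atLeast0)
  show ?thesis
    using assms by (subst (1 2) *, simp_all) (subst sum.swap, simp add: mult.commute)
qed

text \<open>An idempotent is similar to an upper triangular idempotent, whose diagonal entries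
  satisfy t^2 = t; the trace is invariant under similarity.\<close>

lemma trace_idempotent_in_Ints:
  fixes p :: "nat \<Rightarrow> nat \<Rightarrow> complex"
  assumes idem: "\<And>i j. i < n \<Longrightarrow> j < n \<Longrightarrow> (\<Sum>k<n. p i k * p k j) = p i j"
  shows "(\<Sum>i<n. p i i) \<in> \<int>"
proof -
  define A where "A = mat n n (\<lambda>(i, j). p i j)"
  have A: "A \<in> carrier_mat n n" by (simp add: A_def)
  have AA: "A * A = A"
    by (rule eq_matI) (auto simp: A_def scalar_prod_def idem lessThan_atLeast0[symmetric])
  obtain es where es: "char_poly A = (\<Prod>a\<leftarrow>es. [:- a, 1:])"
    using char_poly_factorized[OF A] by blast
  define B where "B = schur_upper_triangular A es"
  have B: "B \<in> carrier_mat n n" "upper_triangular B" "similar_mat A B"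
    using schur_upper_triangular[OF A es] by (simp_all add: B_def)
  obtain P Q where "similar_mat_wit A B P Q"
    using B(3) by (auto simp: similar_mat_def)
  note w = similar_mat_witD2[OF A this]
  have BQ: "B = Q * A * P"
  proof -
    have "Q * A * P = (Q * P) * B * (Q * P)"
      unfolding w(3) using w(5-7) by (simp add: assoc_mult_mat[of _ n n _ n _ n])
    then show ?thesis using w(2,5) by simp
  qed
  have BB: "B * B = B"
  proof -
    have "B * B = Q * A * (P * Q) * A * P"
      unfolding BQ using w(4,6,7) by (simp add: assoc_mult_mat[of _ n n _ n _ n])
    also have "\<dots> = Q * (A * A) * P"
      using w(1,4,6,7) by (simp add: assoc_mult_mat[of _ n n _ n _ n])
    finally show ?thesis by (simp add: AA BQ)
  qed
  have "B $$ (i, i) \<in> \<int>" if i: "i < n" for i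
  proof -
    have "B $$ (i, i) = (\<Sum>k<n. B $$ (i, k) * B $$ (k, i))"
      using B(1) i by (subst BB[symmetric]) (simp add: scalar_prod_def lessThan_atLeast0)
    \<comment> \<open>By triangularity one of the two factors vanishes unless k = i.\<close>
    also have "\<dots> = (\<Sum>k\<in>{i}. B $$ (i, k) * B $$ (k, i))"
    proof (rule sum.mono_neutral_right)
      show "\<forall>k\<in>{..<n} - {i}. B $$ (i, k) * B $$ (k, i) = 0"
      proof
        fix k assume "k \<in> {..<n} - {i}"
        then consider "k < i" | "i < k" "k < n" by force
        then show "B $$ (i, k) * B $$ (k, i) = 0"
        proof cases
          case 1
          then show ?thesis using B(1,2) i by auto
        next
          case 2
          then have "B $$ (k, i) = 0" using B(1,2) by auto
          then show ?thesis by simp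
        qed
      qed
    qed (use i in auto)
    finally have "B $$ (i, i) * (B $$ (i, i) - 1) = 0" by (simp add: algebra_simps)
    then show ?thesis by auto
  qed
  then have "(\<Sum>i<n. B $$ (i, i)) \<in> \<int>" by (intro Ints_sum) auto
  also have "(\<Sum>i<n. B $$ (i, i)) = (\<Sum>i<n. (P * (Q * A)) $$ (i, i))"
    unfolding BQ using w(4,6,7) by (intro trace_mult_commute) auto
  also have "P * (Q * A) = A"
    using w(1,4,6,7) by (simp add: assoc_mult_mat[of _ n n _ n _ n, symmetric])
  finally show ?thesis by (simp add: A_def)
qed

text \<open>For finite A this is (-1)^|A \<inter> V|. For finite T the irreducible characters of
  (Z/2)^T are those with A \<subseteq> T.\<close>

definition sign_char :: "'i set \<Rightarrow> 'i set \<Rightarrow> complex" where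
  "sign_char A V = (\<Prod>i\<in>A. if i \<in> V then - 1 else 1)"

lemma sign_char_sym_diff: "sign_char A (sym_diff V W) = sign_char A V * sign_char A W"
  unfolding sign_char_def prod.distrib[symmetric] by (intro prod.cong) auto

lemma sign_char_empty [simp]: "sign_char A {} = 1"
  by (simp add: sign_char_def)

text \<open>The sum is the expansion of the product over S of 1 plus a sign, and any element of S
  \<inter> V makes a factor vanish.\<close>

lemma sum_sign_char:
  assumes "finite S"
  shows "(\<Sum>A\<in>Pow S. sign_char A V) = (if S \<inter> V = {} then 2 ^ card S else 0)"
proof -
  have "(\<Sum>A\<in>Pow S. sign_char A V) = (\<Prod>i\<in>S. (if i \<in> V then - 1 else 1) + 1)"
    using assms by (subst prod_add) (simp_all add: sign_char_def)
  also have "\<dots> = (if S \<inter> V = {} then 2 ^ card S else 0)"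
  proof (cases "S \<inter> V = {}")
    case True
    then have "(\<Prod>i\<in>S. (if i \<in> V then - 1 else 1) + 1) = (\<Prod>i\<in>S. 2 :: complex)"
      by (intro prod.cong) auto
    then show ?thesis using True by simp
  next
    case False
    then show ?thesis using assms by (auto intro!: prod_zero)
  qed
  finally show ?thesis .
qed

text \<open>Each sign is 2 - 1 or 0 - 1; expanding the product of these differences is Moebius
  inversion of \<open>sum_sign_char\<close>.\<close>

lemma sign_char_expand:
  assumes "finite A"
  shows "sign_char A V = (\<Sum>B\<in>Pow A. if B \<inter> V = {} then (- 1) ^ card (A - B) * 2 ^ card B else 0)"
proof -
  have "sign_char A V = (\<Prod>i\<in>A. (if i \<in> V then 0 else 2) + (- 1))"
    unfolding sign_char_def by (intro prod.cong) auto
  also have "\<dots> = (\<Sum>B\<in>Pow A. (\<Prod>i\<in>B. if i \<in> V then 0 else 2) * (- 1) ^ card (A - B))"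
    using assms by (subst prod_add) simp_all
  also have "\<dots> = (\<Sum>B\<in>Pow A. if B \<inter> V = {} then (- 1) ^ card (A - B) * 2 ^ card B else 0)"
  proof (intro sum.cong refl)
    fix B assume "B \<in> Pow A"
    then have finB: "finite B" using assms finite_subset by auto
    have "(\<Prod>i\<in>B. if i \<in> V then 0 else 2 :: complex) = (if B \<inter> V = {} then 2 ^ card B else 0)"
    proof (cases "B \<inter> V = {}")
      case True
      then have "(\<Prod>i\<in>B. if i \<in> V then 0 else 2 :: complex) = (\<Prod>i\<in>B. 2)"
        by (intro prod.cong) auto
      then show ?thesis using True by simp
    next
      case False
      then show ?thesis using finB by (auto intro!: prod_zero)
    qed
    then show "(\<Prod>i\<in>B. if i \<in> V then 0 else 2) * (- 1) ^ card (A - B) =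
      (if B \<inter> V = {} then (- 1) ^ card (A - B) * 2 ^ card B else (0 :: complex))" by simp
  qed
  finally show ?thesis .
qed

text \<open>The function \<open>V \<mapsto> if V \<subseteq> U then 2 ^ card (T - U) else 0\<close> is the character of
  \<open>(\<int>/2)\<^sup>T\<close> induced from the trivial character of \<open>(\<int>/2)\<^sup>U\<close>.\<close>

definition induced_comb :: "'i set \<Rightarrow> ('i set \<Rightarrow> int) \<Rightarrow> 'i set \<Rightarrow> complex" where
  "induced_comb T a V = (\<Sum>U\<in>Pow T. if V \<subseteq> U then of_int (a U) * 2 ^ card (T - U) else 0)"

lemma sign_comb_eq_induced_comb:
  assumes T: "finite T"
  shows "\<exists>a. \<forall>V\<in>Pow T. (\<Sum>A\<in>Pow T. of_int (c A) * sign_char A V) = induced_comb T a V"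
proof (intro exI ballI)
  \<comment> \<open>U stands for T - B in \<open>sign_char_expand\<close>: for V \<subseteq> T, B is
    disjoint from V exactly if V \<subseteq> T - B, and 2^|B| = 2^|T - U|.\<close>
  define a where "a = (\<lambda>U. \<Sum>A\<in>Pow T. if T - U \<subseteq> A then c A * (- 1) ^ card (A - (T - U)) else 0)"
  fix V assume V: "V \<in> Pow T"
  have "(\<Sum>A\<in>Pow T. of_int (c A) * sign_char A V) =
    (\<Sum>A\<in>Pow T. \<Sum>B\<in>Pow T. if B \<subseteq> A \<and> B \<inter> V = {}
       then of_int (c A) * (- 1) ^ card (A - B) * 2 ^ card B else 0)"
  proof (intro sum.cong refl)
    fix A assume A: "A \<in> Pow T"
    then have "finite A" using T finite_subset by auto
    then have "of_int (c A) * sign_char A V = (\<Sum>B\<in>Pow A. if B \<subseteq> A \<and> B \<inter> V = {}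
       then of_int (c A) * (- 1) ^ card (A - B) * 2 ^ card B else 0)"
      by (simp add: sign_char_expand sum_distrib_left if_distrib cong: if_cong) (auto intro!: sum.cong)
    also have "\<dots> = (\<Sum>B\<in>Pow T. if B \<subseteq> A \<and> B \<inter> V = {}
       then of_int (c A) * (- 1) ^ card (A - B) * 2 ^ card B else 0)"
      using A T by (intro sum.mono_neutral_left) auto
    finally show "of_int (c A) * sign_char A V = \<dots>" .
  qed
  also have "\<dots> = (\<Sum>B\<in>Pow T. if B \<inter> V = {} then of_int (a (T - B)) * 2 ^ card B else 0)"
  proof (subst sum.swap, intro sum.cong refl)
    fix B assume "B \<in> Pow T"
    then have "T - (T - B) = B" by auto
    then show "(\<Sum>A\<in>Pow T. if B \<subseteq> A \<and> B \<inter> V = {}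
       then of_int (c A) * (- 1) ^ card (A - B) * 2 ^ card B else 0) =
      (if B \<inter> V = {} then of_int (a (T - B)) * 2 ^ card B else (0 :: complex))"
      by (auto simp: a_def sum_distrib_right if_distrib intro!: sum.cong)
  qed
  also have "\<dots> = induced_comb T a V"
    unfolding induced_comb_def
  proof (rule sum.reindex_bij_witness[where i = "\<lambda>U. T - U" and j = "\<lambda>U. T - U"])
    fix B assume "B \<in> Pow T"
    then have "T - (T - B) = B" "V \<subseteq> T - B \<longleftrightarrow> B \<inter> V = {}" using V by auto
    then show "(if V \<subseteq> T - B then of_int (a (T - B)) * 2 ^ card (T - (T - B)) else 0) =
      (if B \<inter> V = {} then of_int (a (T - B)) * 2 ^ card B else (0 :: complex))" by simp
  qed auto
  finally show "(\<Sum>A\<in>Pow T. of_int (c A) * sign_char A V) = induced_comb T a V" .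
qed

lemma induced_comb_eq_sign_comb:
  assumes T: "finite T"
  shows "\<exists>c. \<forall>V\<in>Pow T. induced_comb T a V = (\<Sum>A\<in>Pow T. of_int (c A) * sign_char A V)"
proof (intro exI ballI)
  \<comment> \<open>By \<open>sum_sign_char\<close> with S = T - U, the character induced from U is
    the sum of the sign characters of the subsets of T - U.\<close>
  define c where "c = (\<lambda>A. \<Sum>U\<in>Pow T. if A \<subseteq> T - U then a U else 0)"
  fix V assume V: "V \<in> Pow T"
  have "induced_comb T a V = (\<Sum>U\<in>Pow T. of_int (a U) * (\<Sum>A\<in>Pow (T - U). sign_char A V))"
    unfolding induced_comb_def using T V
    by (intro sum.cong refl) (auto simp: sum_sign_char)
  also have "\<dots> = (\<Sum>U\<in>Pow T. \<Sum>A\<in>Pow T. if A \<subseteq> T - U then of_int (a U) * sign_char A V else 0)"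
  proof (intro sum.cong refl)
    fix U
    have "of_int (a U) * (\<Sum>A\<in>Pow (T - U). sign_char A V) =
      (\<Sum>A\<in>Pow (T - U). if A \<subseteq> T - U then of_int (a U) * sign_char A V else 0)"
      by (auto simp: sum_distrib_left intro!: sum.cong)
    also have "\<dots> = (\<Sum>A\<in>Pow T. if A \<subseteq> T - U then of_int (a U) * sign_char A V else 0)"
      using T by (intro sum.mono_neutral_left) auto
    finally show "of_int (a U) * (\<Sum>A\<in>Pow (T - U). sign_char A V) = \<dots>" .
  qed
  also have "\<dots> = (\<Sum>A\<in>Pow T. of_int (c A) * sign_char A V)"
    by (subst sum.swap) (auto simp: c_def sum_distrib_right intro!: sum.cong)
  finally show "induced_comb T a V = (\<Sum>A\<in>Pow T. of_int (c A) * sign_char A V)" .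
qed

text \<open>At V = U only sets containing U contribute, U itself with the nonzero factor 2^|T - U|.
  This triangular system is solved from U = T downwards.\<close>

lemma induced_comb_inject:
  assumes T: "finite T" and eq: "\<And>V. V \<subseteq> T \<Longrightarrow> induced_comb T a V = induced_comb T b V"
    and "U \<subseteq> T"
  shows "a U = b U"
  using \<open>U \<subseteq> T\<close>
proof (induction "card (T - U)" arbitrary: U rule: less_induct)
  case less
  have split: "induced_comb T c U = of_int (c U) * 2 ^ card (T - U) +
    (\<Sum>U'\<in>Pow T - {U}. if U \<subseteq> U' then of_int (c U') * 2 ^ card (T - U') else 0)" for c
    unfolding induced_comb_def using T less.prems by (subst sum.remove[of _ U]) auto
  have "(\<Sum>U'\<in>Pow T - {U}. if U \<subseteq> U' then of_int (a U') * 2 ^ card (T - U') else 0) =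
    (\<Sum>U'\<in>Pow T - {U}. if U \<subseteq> U' then of_int (b U') * 2 ^ card (T - U') else (0 :: complex))"
  proof (intro sum.cong refl if_cong)
    fix U' assume U': "U' \<in> Pow T - {U}" "U \<subseteq> U'"
    then have "T - U' \<subset> T - U" using less.prems by auto
    then have "card (T - U') < card (T - U)" using T by (intro psubset_card_mono) auto
    then have "a U' = b U'" using less.hyps U' by auto
    then show "of_int (a U') * 2 ^ card (T - U') = (of_int (b U') * 2 ^ card (T - U') :: complex)"
      by simp
  qed
  then show ?case using eq[OF less.prems] split[of a] split[of b] by simp
qed

section \<open>Linearity and induction in coordinates\<close>

lemma induced_comb_cong:
  "(\<And>U. U \<subseteq> T \<Longrightarrow> a U = b U) \<Longrightarrow> induced_comb T a V = induced_comb T b V"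
  unfolding induced_comb_def by (intro sum.cong) auto

lemma induced_comb_add:
  "induced_comb T (\<lambda>U. a U + b U) V = induced_comb T a V + induced_comb T b V"
  unfolding induced_comb_def sum.distrib[symmetric] by (intro sum.cong refl) (simp add: distrib_right)

lemma induced_comb_uminus:
  "induced_comb T (\<lambda>U. - a U) V = - induced_comb T a V"
  unfolding induced_comb_def sum_negf[symmetric] by (intro sum.cong refl) simp

lemma induced_comb_zero: "induced_comb T (\<lambda>U. 0) V = 0"
  by (simp add: induced_comb_def)

lemma induced_comb_sum:
  "induced_comb T (\<lambda>U. \<Sum>i\<in>I. b i U * k i) V = (\<Sum>i\<in>I. of_int (k i) * induced_comb T (b i) V)"
proof -
  have "(\<Sum>i\<in>I. of_int (k i) * induced_comb T (b i) V) =
    (\<Sum>U\<in>Pow T. \<Sum>i\<in>I. of_int (k i) * (if V \<subseteq> U then of_int (b i U) * 2 ^ card (T - U) else 0))"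
    unfolding induced_comb_def sum_distrib_left by (rule sum.swap)
  also have "\<dots> = induced_comb T (\<lambda>U. \<Sum>i\<in>I. b i U * k i) V"
    unfolding induced_comb_def
    by (intro sum.cong refl) (simp add: sum_distrib_left mult_ac)
  finally show ?thesis ..
qed

text \<open>Transitivity of induction: the left side is the induction formula for the index 2^|T' -
  T|, and this factor combines with 2^|T - U| to 2^|T' - U|. The coefficients do not change.\<close>

lemma induced_comb_extend:
  assumes T': "finite T'" "T \<subseteq> T'" and a: "\<And>U. \<not> U \<subseteq> T \<Longrightarrow> a U = 0"
  shows "(if V \<subseteq> T then 2 ^ card (T' - T) * induced_comb T a V else 0) = induced_comb T' a V"
proof -
  have "induced_comb T' a V = (\<Sum>U\<in>Pow T. if V \<subseteq> U then of_int (a U) * 2 ^ card (T' - U) else 0)"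
    unfolding induced_comb_def using T' a by (intro sum.mono_neutral_right) auto
  also have "\<dots> = (\<Sum>U\<in>Pow T. 2 ^ card (T' - T) * (if V \<subseteq> U then of_int (a U) * 2 ^ card (T - U) else 0))"
  proof (intro sum.cong refl)
    fix U assume "U \<in> Pow T"
    then have "T' - U = (T' - T) \<union> (T - U)" using T' by auto
    moreover have "card ((T' - T) \<union> (T - U)) = card (T' - T) + card (T - U)"
      using T'(1) finite_subset[OF T'(2,1)] by (intro card_Un_disjoint) auto
    ultimately show "(if V \<subseteq> U then of_int (a U) * 2 ^ card (T' - U) else 0) =
      2 ^ card (T' - T) * (if V \<subseteq> U then of_int (a U) * 2 ^ card (T - U) else (0 :: complex))"
      by (simp add: power_add)
  qed
  also have "\<dots> = 2 ^ card (T' - T) * induced_comb T a V"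
    by (simp add: induced_comb_def sum_distrib_left)
  also have "\<dots> = (if V \<subseteq> T then 2 ^ card (T' - T) * induced_comb T a V else 0)"
  proof (cases "V \<subseteq> T")
    case False
    then have "\<not> V \<subseteq> U" if "U \<in> Pow T" for U using that by auto
    then have "induced_comb T a V = 0" unfolding induced_comb_def by (intro sum.neutral) simp
    then show ?thesis by simp
  qed simp
  finally show ?thesis ..
qed

text \<open>K is seen only through its coordinate map v. The same map \<open>supp\<close> later
  serves for a special subgroup and all its conjugates, so no isomorphisms between them have to be
  carried along.\<close>

locale elementary_abelian_subgroup = group G for G (structure) +
  fixes K :: "'a set" and v :: "'a \<Rightarrow> 'i set" and T :: "'i set"
  assumes sub: "subgroup K G" and fin: "finite T" and bij: "bij_betw v K (Pow T)"
    and v_mult: "\<And>x y. x \<in> K \<Longrightarrow> y \<in> K \<Longrightarrow> v (x \<otimes> y) = sym_diff (v x) (v y)"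
begin

lemma v_subset: "x \<in> K \<Longrightarrow> v x \<subseteq> T"
  using bij by (auto simp: bij_betw_def)

lemma v_inject: "x \<in> K \<Longrightarrow> y \<in> K \<Longrightarrow> v x = v y \<longleftrightarrow> x = y"
  using bij by (auto simp: bij_betw_def inj_on_def)

lemma finite_K: "finite K" and card_K: "card K = 2 ^ card T"
  using bij_betw_finite[OF bij] bij_betw_same_card[OF bij] fin by (simp_all add: card_Pow)

lemma one_K: "\<one> \<in> K" and mult_K: "x \<in> K \<Longrightarrow> y \<in> K \<Longrightarrow> x \<otimes> y \<in> K"
  and K_carrier: "x \<in> K \<Longrightarrow> x \<in> carrier G"
  using sub by (auto simp: subgroup_def)

lemma v_one: "v \<one> = {}"
  using v_mult[OF one_K one_K] by simp

lemma mult_commute_K: "x \<in> K \<Longrightarrow> y \<in> K \<Longrightarrow> x \<otimes> y = y \<otimes> x"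
  using v_inject[of "x \<otimes> y" "y \<otimes> x"] by (auto simp: mult_K v_mult)

lemma sum_translate:
  assumes "x \<in> K"
  shows "(\<Sum>y\<in>K. f (x \<otimes> y)) = (\<Sum>y\<in>K. f y)"
proof (rule sum.reindex_bij_witness[where i = "\<lambda>y. inv x \<otimes> y" and j = "\<lambda>y. x \<otimes> y"])
  fix y assume y: "y \<in> K"
  have c: "x \<in> carrier G" "y \<in> carrier G" using assms y K_carrier by auto
  show "inv x \<otimes> (x \<otimes> y) = y" "x \<otimes> (inv x \<otimes> y) = y"
    using c by (simp_all add: m_assoc[symmetric])
  show "inv x \<otimes> y \<in> K" using assms y sub by (simp add: subgroup.m_inv_closed mult_K)
qed (use assms in \<open>auto simp: mult_K\<close>)

text \<open>Fourier inversion on (Z/2)^T: the Fourier coefficients are the multiplicities of the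
  sign characters, and they are integers as traces of projectors.\<close>

lemma rep_character_eq_sign_comb:
  assumes rep: "is_representation G K n \<rho>"
  shows "\<exists>c. \<forall>x\<in>K. rep_character K n \<rho> x = (\<Sum>A\<in>Pow T. of_int (c A) * sign_char A (v x))"
proof -
  define \<chi> where "\<chi> = rep_character K n \<rho>"
  \<comment> \<open>The projector onto the A-isotypic part. Signs are real and their own inverses,
    so no conjugate appears.\<close>
  define p where "p = (\<lambda>A i j. (\<Sum>x\<in>K. sign_char A (v x) * \<rho> x i j) / of_nat (card K))"
  have K0: "of_nat (card K) \<noteq> (0 :: complex)" by (simp add: card_K)
  have tr: "(\<Sum>i<n. p A i i) \<in> \<int>" for A
  proof (rule trace_idempotent_in_Ints[of n "p A"])
    fix i j assume ij: "i < n" "j < n"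
    have "(\<Sum>k<n. p A i k * p A k j) = (\<Sum>k<n. \<Sum>x\<in>K. \<Sum>y\<in>K.
      (sign_char A (v x) * sign_char A (v y)) * (\<rho> x i k * \<rho> y k j)) / of_nat (card K) ^ 2"
      unfolding p_def times_divide_times_eq sum_product power2_eq_square sum_divide_distrib[symmetric]
      by (intro arg_cong2[where f = "(/)"] sum.cong refl) (simp add: mult_ac)
    also have "(\<Sum>k<n. \<Sum>x\<in>K. \<Sum>y\<in>K. (sign_char A (v x) * sign_char A (v y)) * (\<rho> x i k * \<rho> y k j)) =
      (\<Sum>x\<in>K. \<Sum>y\<in>K. \<Sum>k<n. (sign_char A (v x) * sign_char A (v y)) * (\<rho> x i k * \<rho> y k j))"
      by (subst sum.swap, intro sum.cong refl, subst sum.swap) simp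
    also have "\<dots> = (\<Sum>x\<in>K. \<Sum>y\<in>K. sign_char A (v (x \<otimes> y)) * \<rho> (x \<otimes> y) i j)"
      using rep ij unfolding is_representation_def
      by (intro sum.cong refl) (simp add: sum_distrib_left[symmetric] v_mult sign_char_sym_diff)
    also have "\<dots> = (\<Sum>x\<in>K. \<Sum>y\<in>K. sign_char A (v y) * \<rho> y i j)"
      by (intro sum.cong refl sum_translate)
    also have "\<dots> = of_nat (card K) * (\<Sum>y\<in>K. sign_char A (v y) * \<rho> y i j)" by simp
    finally show "(\<Sum>k<n. p A i k * p A k j) = p A i j"
      using K0 by (simp add: p_def power2_eq_square)
  qed
  \<comment> \<open>The trace is already an integer; the floor only converts it to type int.\<close>
  define c where "c = (\<lambda>A. \<lfloor>Re (\<Sum>i<n. p A i i)\<rfloor>)"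
  have c: "of_int (c A) = (\<Sum>i<n. p A i i)" for A
  proof -
    obtain z where "(\<Sum>i<n. p A i i) = of_int z" using tr[of A] by (auto elim: Ints_cases)
    then show ?thesis by (simp only: c_def) simp
  qed
  have c': "of_int (c A) = (\<Sum>y\<in>K. sign_char A (v y) * \<chi> y) / of_nat (card K)" for A
  proof -
    have "(\<Sum>i<n. p A i i) = (\<Sum>y\<in>K. sign_char A (v y) * (\<Sum>i<n. \<rho> y i i)) / of_nat (card K)"
      unfolding p_def sum_divide_distrib[symmetric] sum_distrib_left
      by (subst sum.swap) simp
    then show ?thesis by (simp add: c \<chi>_def rep_character_def)
  qed
  have "\<chi> x = (\<Sum>A\<in>Pow T. of_int (c A) * sign_char A (v x))" if x: "x \<in> K" for x
  proof -
    have "(\<Sum>A\<in>Pow T. of_int (c A) * sign_char A (v x)) =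
      (\<Sum>A\<in>Pow T. \<Sum>y\<in>K. sign_char A (v (x \<otimes> y)) * \<chi> y) / of_nat (card K)"
      using x by (simp add: c' sum_divide_distrib sum_distrib_right sum_distrib_left v_mult
        sign_char_sym_diff mult_ac)
    also have "(\<Sum>A\<in>Pow T. \<Sum>y\<in>K. sign_char A (v (x \<otimes> y)) * \<chi> y) =
      (\<Sum>y\<in>K. (\<Sum>A\<in>Pow T. sign_char A (v (x \<otimes> y))) * \<chi> y)"
      by (subst sum.swap) (simp add: sum_distrib_right)
    \<comment> \<open>Orthogonality: the sum over A vanishes unless \<open>x \<otimes> y\<close> has
      empty coordinates, that is, unless x = y.\<close>
    also have "\<dots> = (\<Sum>y\<in>K. if y = x then of_nat (card K) * \<chi> y else 0)"
    proof (intro sum.cong refl)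
      fix y assume y: "y \<in> K"
      have "T \<inter> v (x \<otimes> y) = {} \<longleftrightarrow> v x = v y"
        using v_subset[OF x] v_subset[OF y] by (auto simp: v_mult x y)
      also have "\<dots> \<longleftrightarrow> y = x" using v_inject[OF x y] by auto
      finally show "(\<Sum>A\<in>Pow T. sign_char A (v (x \<otimes> y))) * \<chi> y =
        (if y = x then of_nat (card K) * \<chi> y else 0)"
        using fin by (simp add: sum_sign_char card_K)
    qed
    also have "\<dots> = of_nat (card K) * \<chi> x" using x finite_K by simp
    finally show ?thesis using K0 by simp
  qed
  then show ?thesis by (auto simp: \<chi>_def)
qed

lemma diagonal_representation:
  "is_representation G K (length As) (\<lambda>x i j. if i = j then sign_char (As ! i) (v x) else 0)"
  unfolding is_representation_def
proof (intro conjI allI ballI impI)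
  fix x y i j assume "x \<in> K" "y \<in> K" and i: "i < length As"
  have "(\<Sum>k<length As. (if i = k then sign_char (As ! i) (v x) else 0) *
      (if k = j then sign_char (As ! k) (v y) else 0)) =
    (\<Sum>k<length As. if k = i then (if i = j then sign_char (As ! i) (v x) * sign_char (As ! i) (v y) else 0) else 0)"
    by (intro sum.cong) auto
  also have "\<dots> = (if i = j then sign_char (As ! i) (v (x \<otimes> y)) else 0)"
    using \<open>x \<in> K\<close> \<open>y \<in> K\<close> i by (simp add: v_mult sign_char_sym_diff)
  finally show "(if i = j then sign_char (As ! i) (v (x \<otimes> y)) else 0) =
    (\<Sum>k<length As. (if i = k then sign_char (As ! i) (v x) else 0) *
      (if k = j then sign_char (As ! k) (v y) else 0))" ..
qed (simp add: v_one)

lemma nat_comb_is_character: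
  fixes k :: "'i set \<Rightarrow> nat"
  shows "\<exists>n \<rho>. is_representation G K n \<rho> \<and>
    (\<forall>x\<in>K. rep_character K n \<rho> x = (\<Sum>A\<in>Pow T. of_nat (k A) * sign_char A (v x)))"
proof -
  obtain xs where xs: "set xs = Pow T" "distinct xs"
    using finite_distinct_list[of "Pow T"] fin by auto
  \<comment> \<open>Each A is listed with multiplicity k A; the diagonal representation along the
    list is the corresponding direct sum.\<close>
  define As where "As = concat (map (\<lambda>A. replicate (k A) A) xs)"
  have sum_As: "sum_list (map f As) = (\<Sum>A\<in>Pow T. of_nat (k A) * f A)" for f :: "'i set \<Rightarrow> complex"
  proof -
    have "sum_list (map f (concat (map (\<lambda>A. replicate (k A) A) ys))) =
      sum_list (map (\<lambda>A. of_nat (k A) * f A) ys)" for ys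
      by (induction ys) (simp_all add: sum_list_replicate)
    then show ?thesis
      using xs by (simp add: As_def sum_list_distinct_conv_sum_set)
  qed
  have "rep_character K (length As) (\<lambda>x i j. if i = j then sign_char (As ! i) (v x) else 0) x =
    (\<Sum>A\<in>Pow T. of_nat (k A) * sign_char A (v x))" if "x \<in> K" for x
    using that sum_As[of "\<lambda>A. sign_char A (v x)"]
    by (simp add: rep_character_def sum_list_sum_nth lessThan_atLeast0)
  then show ?thesis using diagonal_representation by blast
qed

text \<open>The sign characters and the induced trivial characters span the same lattice. For the
  converse, positive and negative multiplicities of sign characters go to the two representations of
  the difference.\<close>

lemma rep_ring_iff:
  "\<phi> \<in> rep_ring G K \<longleftrightarrow>
    (\<forall>x. x \<notin> K \<longrightarrow> \<phi> x = 0) \<and> (\<exists>a. \<forall>x\<in>K. \<phi> x = induced_comb T a (v x))"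
proof
  assume "\<phi> \<in> rep_ring G K"
  then obtain n1 \<rho>1 n2 \<rho>2 where rep: "is_representation G K n1 \<rho>1" "is_representation G K n2 \<rho>2"
    and \<phi>: "\<phi> = (\<lambda>x. rep_character K n1 \<rho>1 x - rep_character K n2 \<rho>2 x)"
    by (auto simp: rep_ring_def)
  obtain c1 c2 where c:
    "\<forall>x\<in>K. rep_character K n1 \<rho>1 x = (\<Sum>A\<in>Pow T. of_int (c1 A) * sign_char A (v x))"
    "\<forall>x\<in>K. rep_character K n2 \<rho>2 x = (\<Sum>A\<in>Pow T. of_int (c2 A) * sign_char A (v x))"
    using rep_character_eq_sign_comb[OF rep(1)] rep_character_eq_sign_comb[OF rep(2)] by blast
  obtain a where a: "\<forall>V\<in>Pow T. (\<Sum>A\<in>Pow T. of_int (c1 A - c2 A) * sign_char A V) = induced_comb T a V"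
    using sign_comb_eq_induced_comb[OF fin, of "\<lambda>A. c1 A - c2 A"] by blast
  have "\<phi> x = induced_comb T a (v x)" if x: "x \<in> K" for x
  proof -
    have "\<phi> x = (\<Sum>A\<in>Pow T. of_int (c1 A - c2 A) * sign_char A (v x))"
      using c x by (simp add: \<phi> sum_subtractf left_diff_distrib)
    then show ?thesis using a v_subset[OF x] by simp
  qed
  then show "(\<forall>x. x \<notin> K \<longrightarrow> \<phi> x = 0) \<and> (\<exists>a. \<forall>x\<in>K. \<phi> x = induced_comb T a (v x))"
    by (auto simp: \<phi> rep_character_def)
next
  assume *: "(\<forall>x. x \<notin> K \<longrightarrow> \<phi> x = 0) \<and> (\<exists>a. \<forall>x\<in>K. \<phi> x = induced_comb T a (v x))"
  then obtain a where a: "\<And>x. x \<in> K \<Longrightarrow> \<phi> x = induced_comb T a (v x)" by blast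
  obtain c where c: "\<And>V. V \<in> Pow T \<Longrightarrow> induced_comb T a V = (\<Sum>A\<in>Pow T. of_int (c A) * sign_char A V)"
    using induced_comb_eq_sign_comb[OF fin] by blast
  obtain n1 \<rho>1 n2 \<rho>2 where rep: "is_representation G K n1 \<rho>1" "is_representation G K n2 \<rho>2"
    and ch: "\<And>x. x \<in> K \<Longrightarrow> rep_character K n1 \<rho>1 x = (\<Sum>A\<in>Pow T. of_nat (nat (c A)) * sign_char A (v x))"
      "\<And>x. x \<in> K \<Longrightarrow> rep_character K n2 \<rho>2 x = (\<Sum>A\<in>Pow T. of_nat (nat (- c A)) * sign_char A (v x))"
    using nat_comb_is_character[of "\<lambda>A. nat (c A)"] nat_comb_is_character[of "\<lambda>A. nat (- c A)"] by blast
  have nat: "of_nat (nat z) - of_nat (nat (- z)) = (of_int z :: complex)" for z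
    by (cases "z \<ge> 0") auto
  have "\<phi> = (\<lambda>x. rep_character K n1 \<rho>1 x - rep_character K n2 \<rho>2 x)"
  proof
    fix x
    show "\<phi> x = rep_character K n1 \<rho>1 x - rep_character K n2 \<rho>2 x"
    proof (cases "x \<in> K")
      case True
      then show ?thesis
        using v_subset[OF True]
        by (simp add: a c ch sum_subtractf[symmetric] left_diff_distrib[symmetric] nat)
    next
      case False
      then show ?thesis using * by (simp add: rep_character_def)
    qed
  qed
  then show "\<phi> \<in> rep_ring G K" using rep by (auto simp: rep_ring_def)
qed

end

section \<open>Right-angled Coxeter groups\<close>

lemma trivial_group_Mod_carrier:
  assumes "group G"
  shows "trivial_group (G Mod carrier G)"
proof -
  interpret group G by fact
  have "carrier G #>\<^bsub>G\<^esub> x = carrier G" if "x \<in> carrier G" for x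
    using that by (intro coset_join2 subgroup_self)
  then have "rcosets\<^bsub>G\<^esub> carrier G = {carrier G}"
    using one_closed by (auto simp: RCOSETS_def)
  moreover have "group (G Mod carrier G)"
    by (intro normal.factorgroup_is_group normal_self)
  ultimately show ?thesis by (simp add: trivial_group_def FactGroup_def)
qed

text \<open>The definition tests groups carried by nat only; a group on a countable type is
  transported along \<open>to_nat\<close>, and the homomorphism is brought back by
  \<open>from_nat\<close>.\<close>

lemma coxeter_system_universal:
  fixes H :: "('h :: countable) monoid"
  assumes cox: "coxeter_system G N m s" and H: "group H" and rel: "coxeter_relations H N m h"
  shows "\<exists>\<phi>\<in>hom G H. \<forall>i<N. \<phi> (s i) = h i"
proof -
  interpret H: group H by fact
  define H' :: "nat monoid" where "H' = \<lparr>carrier = to_nat ` carrier H,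
    monoid.mult = (\<lambda>x y. to_nat (from_nat x \<otimes>\<^bsub>H\<^esub> from_nat y)), one = to_nat \<one>\<^bsub>H\<^esub>\<rparr>"
  have carr: "carrier H' = to_nat ` carrier H"
    and mlt: "x \<otimes>\<^bsub>H'\<^esub> y = to_nat (from_nat x \<otimes>\<^bsub>H\<^esub> from_nat y)" for x y
    by (simp_all add: H'_def)
  have iso: "(to_nat :: 'h \<Rightarrow> nat) \<in> iso H H'"
    by (auto simp: iso_def hom_def H'_def bij_betw_def inj_on_def)
  then have "group (H'\<lparr>one := to_nat \<one>\<^bsub>H\<^esub>\<rparr>)" by (rule H.iso_imp_img_group)
  then have gH': "group H'" by (simp add: H'_def)
  interpret t: group_hom H H' to_nat
    using H gH' iso by (simp add: group_hom_def group_hom_axioms_def iso_def)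
  have "coxeter_relations H' N m (\<lambda>i. to_nat (h i))"
    using rel unfolding coxeter_relations_def
    by (auto simp: t.hom_nat_pow[symmetric] t.hom_mult[symmetric] simp del: t.hom_mult)
  then obtain \<phi> where \<phi>: "\<phi> \<in> hom G H'" "\<forall>i<N. \<phi> (s i) = to_nat (h i)"
    using cox gH' unfolding coxeter_system_def by blast
  have "(\<lambda>x. from_nat (\<phi> x)) \<in> hom G H"
  proof (rule homI)
    fix x assume "x \<in> carrier G"
    then have "\<phi> x \<in> to_nat ` carrier H" unfolding carr[symmetric] by (rule hom_in_carrier[OF \<phi>(1)])
    then show "from_nat (\<phi> x) \<in> carrier H" by auto
  next
    fix x y assume "x \<in> carrier G" "y \<in> carrier G"
    then show "from_nat (\<phi> (x \<otimes>\<^bsub>G\<^esub> y)) = from_nat (\<phi> x) \<otimes>\<^bsub>H\<^esub> from_nat (\<phi> y)"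
      by (simp only: hom_mult[OF \<phi>(1)] mlt from_nat_to_nat)
  qed
  moreover have "\<forall>i<N. from_nat (\<phi> (s i)) = h i" using \<phi>(2) by simp
  ultimately show ?thesis by (intro bexI[of _ "\<lambda>x. from_nat (\<phi> x)"])
qed

text \<open>\<open>(a, e)\<close> is the isometry \<open>x \<mapsto> a - x\<close> of \<open>\<int>\<close> if \<open>e\<close>, and \<open>x \<mapsto> a + x\<close> otherwise.\<close>

definition infinite_dihedral :: "(int \<times> bool) monoid" where
  "infinite_dihedral = \<lparr>carrier = UNIV,
     monoid.mult = (\<lambda>(a, e) (b, f). (if e then a - b else a + b, e \<noteq> f)), one = (0, False)\<rparr>"

lemma group_infinite_dihedral: "group infinite_dihedral"
proof (rule groupI)
  fix x :: "int \<times> bool"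
  show "\<exists>y\<in>carrier infinite_dihedral. y \<otimes>\<^bsub>infinite_dihedral\<^esub> x = \<one>\<^bsub>infinite_dihedral\<^esub>"
    by (cases x, rule bexI[of _ "(if snd x then fst x else - fst x, snd x)"])
      (auto simp: infinite_dihedral_def)
qed (auto simp: infinite_dihedral_def split: prod.splits)

text \<open>The finite exponents are 1 on the diagonal and 2 off it, so the relations only ask for
  involutions and for the commutation of pairs with m i j = 2.\<close>

lemma (in group) right_angled_coxeter_relationsI:
  assumes "coxeter_matrix N m" "right_angled N m"
    and closed: "\<And>i. i < N \<Longrightarrow> h i \<in> carrier G"
    and sq: "\<And>i. i < N \<Longrightarrow> h i \<otimes> h i = \<one>"
    and comm: "\<And>i j. i < N \<Longrightarrow> j < N \<Longrightarrow> i \<noteq> j \<Longrightarrow> m i j = 2 \<Longrightarrow> h i \<otimes> h j = h j \<otimes> h i"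
  shows "coxeter_relations G N m h"
  unfolding coxeter_relations_def
proof (intro conjI allI impI)
  fix i j :: nat and k :: nat
  assume ij: "i < N" "j < N" and k: "m i j = enat k"
  show "(h i \<otimes> h j) [^] k = \<one>"
  proof (cases "i = j")
    case True
    then show ?thesis using ij sq by simp
  next
    case False
    then have "m i j = 2 \<or> m i j = \<infinity>" using assms(2) ij by (auto simp: right_angled_def)
    then have m2: "m i j = 2" using k by simp
    then have k2: "k = 2" using k by (simp add: numeral_eq_enat)
    have c: "h i \<in> carrier G" "h j \<in> carrier G" using closed ij by auto
    have "(h i \<otimes> h j) \<otimes> (h i \<otimes> h j) = (h i \<otimes> h j) \<otimes> (h j \<otimes> h i)"
      using comm[OF ij False m2] by simp
    also have "\<dots> = h i \<otimes> (h j \<otimes> h j) \<otimes> h i" using c by (simp add: m_assoc)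
    finally have "(h i \<otimes> h j) \<otimes> (h i \<otimes> h j) = \<one>" using sq ij c by simp
    then show ?thesis using c by (simp add: k2 numeral_2_eq_2)
  qed
qed (use closed in auto)

locale right_angled_coxeter = group G for G (structure) +
  fixes N :: nat and m :: "nat \<Rightarrow> nat \<Rightarrow> enat" and s :: "nat \<Rightarrow> 'a"
  assumes cox: "coxeter_system G N m s" and ra: "right_angled N m"
begin

abbreviation W :: "nat set \<Rightarrow> 'a set" where
  "W T \<equiv> special_subgroup G s T"

section \<open>Relations among the generators\<close>

lemma s_closed: "i < N \<Longrightarrow> s i \<in> carrier G"
  using cox by (auto simp: coxeter_system_def coxeter_relations_def)

lemma s_pow: "i < N \<Longrightarrow> j < N \<Longrightarrow> m i j = enat k \<Longrightarrow> (s i \<otimes> s j) [^] k = \<one>"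
  using cox by (auto simp: coxeter_system_def coxeter_relations_def)

lemma s_sq: "i < N \<Longrightarrow> s i \<otimes> s i = \<one>"
  using s_pow[of i i 1] cox s_closed[of i]
  by (auto simp: coxeter_system_def coxeter_matrix_def one_enat_def)

lemma s_commute:
  assumes "i < N" "j < N" "m i j = 2"
  shows "s i \<otimes> s j = s j \<otimes> s i"
proof -
  have c: "s i \<in> carrier G" "s j \<in> carrier G" using assms s_closed by auto
  have "s i \<otimes> s j \<otimes> (s i \<otimes> s j) = \<one>"
    using s_pow[of i j 2] assms c by (simp add: numeral_eq_enat numeral_2_eq_2)
  then have "inv (s i \<otimes> s j) = s i \<otimes> s j" using c by (simp add: inv_equality)
  moreover have "inv (s i) = s i" "inv (s j) = s j" using c assms s_sq by (simp_all add: inv_equality)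
  ultimately show ?thesis using c by (simp add: inv_mult_group)
qed

text \<open>One target serves two purposes: its second coordinate counts a generator modulo two, and
  a pair of its reflections detects a product of infinite order.\<close>

lemma hom_infinite_dihedral_exists:
  assumes "\<And>i. i < N \<Longrightarrow> h i \<otimes>\<^bsub>infinite_dihedral\<^esub> h i = \<one>\<^bsub>infinite_dihedral\<^esub>"
    and "\<And>i j. i < N \<Longrightarrow> j < N \<Longrightarrow> i \<noteq> j \<Longrightarrow> m i j = 2 \<Longrightarrow>
      h i \<otimes>\<^bsub>infinite_dihedral\<^esub> h j = h j \<otimes>\<^bsub>infinite_dihedral\<^esub> h i"
  shows "\<exists>\<phi>\<in>hom G infinite_dihedral. \<forall>i<N. \<phi> (s i) = h i"
proof (rule coxeter_system_universal[OF cox group_infinite_dihedral])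
  show "coxeter_relations infinite_dihedral N m h"
    using cox ra assms
    by (intro group.right_angled_coxeter_relationsI[OF group_infinite_dihedral])
      (auto simp: coxeter_system_def infinite_dihedral_def)
qed

lemma supp_exists:
  "\<exists>v. (\<forall>x\<in>carrier G. \<forall>y\<in>carrier G. v (x \<otimes> y) = sym_diff (v x) (v y)) \<and> (\<forall>i<N. v (s i) = {i})"
proof -
  \<comment> \<open>Only \<open>s k\<close> goes to a reflection, the other generators go to the
    identity; the second coordinate is then the parity of \<open>s k\<close> in a word.\<close>
  have "\<exists>\<phi>\<in>hom G infinite_dihedral. \<forall>i<N. \<phi> (s i) = (0, i = k)" for k
    by (rule hom_infinite_dihedral_exists) (auto simp: infinite_dihedral_def)
  then obtain \<phi> where \<phi>: "\<And>k. \<phi> k \<in> hom G infinite_dihedral" "\<And>k i. i < N \<Longrightarrow> \<phi> k (s i) = (0, i = k)"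
    by metis
  have "snd (\<phi> k (x \<otimes> y)) \<longleftrightarrow> snd (\<phi> k x) \<noteq> snd (\<phi> k y)" if "x \<in> carrier G" "y \<in> carrier G" for k x y
    using that hom_mult[OF \<phi>(1)[of k]] by (auto simp: infinite_dihedral_def split: prod.splits)
  then show ?thesis
    using \<phi>(2) by (intro exI[of _ "\<lambda>x. {k. k < N \<and> snd (\<phi> k x)}"]) auto
qed

text \<open>The abelianization map \<open>W \<rightarrow> (\<int>/2)\<^sup>N\<close>, with values written as subsets of \<open>{..<N}\<close>.
  Being conjugation invariant and injective on every finite subgroup in sight, it makes the
  choice of cell representatives invisible.\<close>

definition supp :: "'a \<Rightarrow> nat set" where
  "supp = (SOME v. (\<forall>x\<in>carrier G. \<forall>y\<in>carrier G. v (x \<otimes> y) = sym_diff (v x) (v y)) \<and>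
     (\<forall>i<N. v (s i) = {i}))"

lemma supp_mult: "x \<in> carrier G \<Longrightarrow> y \<in> carrier G \<Longrightarrow> supp (x \<otimes> y) = sym_diff (supp x) (supp y)"
  and supp_s: "i < N \<Longrightarrow> supp (s i) = {i}"
  using someI_ex[OF supp_exists] unfolding supp_def[symmetric] by auto

lemma supp_one: "supp \<one> = {}"
  using supp_mult[of \<one> \<one>] by simp

lemma supp_inv: "x \<in> carrier G \<Longrightarrow> supp (inv x) = supp x"
  using supp_mult[of x "inv x"] supp_one by auto

lemma supp_conj: "g \<in> carrier G \<Longrightarrow> x \<in> carrier G \<Longrightarrow> supp (g \<otimes> x \<otimes> inv g) = supp x"
  and supp_conj': "g \<in> carrier G \<Longrightarrow> x \<in> carrier G \<Longrightarrow> supp (inv g \<otimes> x \<otimes> g) = supp x"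
  by (auto simp: supp_mult supp_inv)

section \<open>Special subgroups\<close>

lemma s_image_carrier: "T \<subseteq> {..<N} \<Longrightarrow> s ` T \<subseteq> carrier G"
  using s_closed by auto

lemma W_subgroup: "T \<subseteq> {..<N} \<Longrightarrow> subgroup (W T) G"
  unfolding special_subgroup_def by (intro generate_is_subgroup s_image_carrier)

lemma W_mono: "T \<subseteq> U \<Longrightarrow> W T \<subseteq> W U"
  unfolding special_subgroup_def by (intro mono_generate) auto

lemma s_in_W: "i \<in> T \<Longrightarrow> s i \<in> W T"
  by (auto simp: special_subgroup_def intro: generate.incl)

lemma inv_s: "i < N \<Longrightarrow> inv (s i) = s i"
  by (simp add: inv_equality s_sq s_closed)

text \<open>The generators are involutions, so the inverse case of \<open>generate\<close> reduces
  to the generator case.\<close>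

lemma W_induct [consumes 2, case_names one gen mult]:
  assumes "x \<in> W T" "T \<subseteq> {..<N}" "P \<one>" "\<And>i. i \<in> T \<Longrightarrow> P (s i)"
    and "\<And>x y. x \<in> W T \<Longrightarrow> y \<in> W T \<Longrightarrow> P x \<Longrightarrow> P y \<Longrightarrow> P (x \<otimes> y)"
  shows "P x"
  using assms(1) unfolding special_subgroup_def
proof (induction rule: generate.induct)
  case (inv h)
  then show ?case using assms(2,4) by (auto simp: inv_s subset_iff)
next
  case (eng h1 h2)
  then show ?case using assms(5) by (simp add: special_subgroup_def)
qed (use assms(3,4) in auto)

lemma W_carrier: "T \<subseteq> {..<N} \<Longrightarrow> x \<in> W T \<Longrightarrow> x \<in> carrier G"
  by (rule subgroup.mem_carrier[OF W_subgroup])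

lemma supp_W:
  assumes "T \<subseteq> {..<N}" "x \<in> W T"
  shows "supp x \<subseteq> T"
  using assms(2,1)
proof (induction rule: W_induct)
  case (mult x y)
  then show ?case using W_carrier[OF assms(1)] by (auto simp: supp_mult)
qed (use assms in \<open>auto simp: supp_one supp_s subset_iff\<close>)

lemma spherical_imp_pairwise_commute:
  assumes sph: "spherical G N s T" and ij: "i \<in> T" "j \<in> T" "i \<noteq> j"
  shows "m i j = 2"
proof (rule ccontr)
  assume "m i j \<noteq> 2"
  have T: "T \<subseteq> {..<N}" "finite (W T)" using sph by (auto simp: spherical_def)
  then have lt: "i < N" "j < N" using ij by auto
  then have inf: "m i j = \<infinity>" "m j i = \<infinity>"
    using ra cox ij \<open>m i j \<noteq> 2\<close> by (auto simp: right_angled_def coxeter_system_def coxeter_matrix_def)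
  \<comment> \<open>The reflections x \<mapsto> - x and x \<mapsto> 1 - x compose to the translation
    by -1, which has infinite order. Commutation fails only for i and j, where m i j is infinite and
    imposes no relation.\<close>
  define h :: "nat \<Rightarrow> int \<times> bool" where
    "h = (\<lambda>k. if k = i then (0, True) else if k = j then (1, True) else (0, False))"
  have "\<exists>\<phi>\<in>hom G infinite_dihedral. \<forall>i<N. \<phi> (s i) = h i"
    using inf by (intro hom_infinite_dihedral_exists) (auto simp: h_def infinite_dihedral_def)
  then obtain \<phi> where \<phi>: "\<phi> \<in> hom G infinite_dihedral" "\<And>k. k < N \<Longrightarrow> \<phi> (s k) = h k" by blast
  interpret \<phi>: group_hom G infinite_dihedral \<phi>
    using \<phi>(1) group_infinite_dihedral is_group by (simp add: group_hom_def group_hom_axioms_def)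
  have c: "s i \<in> carrier G" "s j \<in> carrier G" using s_closed lt by auto
  have *: "\<phi> ((s i \<otimes> s j) [^] n) = (- int n, False)" for n :: nat
  proof (induction n)
    case (Suc n)
    then show ?case using \<phi>(2) lt ij c by (simp add: h_def) (simp add: infinite_dihedral_def)
  qed (simp add: infinite_dihedral_def)
  have "inj (\<lambda>n::nat. (s i \<otimes> s j) [^] n)"
    by (rule injI) (metis * Pair_inject minus_equation_iff of_nat_eq_iff)
  moreover have "(s i \<otimes> s j) [^] n \<in> W T" for n :: nat
    using W_subgroup[OF T(1)] s_in_W[of i T] s_in_W[of j T] ij
    by (induction n) (auto simp: subgroup.one_closed subgroup.m_closed)
  ultimately have "infinite (W T)"
    by (intro infinite_super[OF _ range_inj_infinite]) auto
  then show False using T by simp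
qed

text \<open>As \<open>s t\<close> is an involution commuting with W T, the union of W T and its
  translate by \<open>s t\<close> is closed under multiplication.\<close>

lemma W_insert:
  assumes T: "insert t T \<subseteq> {..<N}" and comm: "\<And>i. i \<in> T \<Longrightarrow> s t \<otimes> s i = s i \<otimes> s t"
    and x: "x \<in> W (insert t T)"
  shows "x \<in> W T \<or> (\<exists>y\<in>W T. x = s t \<otimes> y)"
proof -
  have TN: "T \<subseteq> {..<N}" "t < N" using T by auto
  note sg = W_subgroup[OF TN(1)]
  have st: "s t \<in> carrier G" using s_closed TN by simp
  have comm': "y \<otimes> s t = s t \<otimes> y" if "y \<in> W T" for y
    using that TN(1)
  proof (induction rule: W_induct)
    case (mult x y)
    then have "x \<in> carrier G" "y \<in> carrier G" using W_carrier TN(1) by auto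
    then show ?case using mult st by (metis m_assoc)
  qed (use comm st in auto)
  show ?thesis using x T
  proof (induction rule: W_induct)
    case one
    then show ?case using subgroup.one_closed[OF sg] by simp
  next
    case (gen i)
    show ?case
    proof (cases "i = t")
      case True
      then show ?thesis using subgroup.one_closed[OF sg] st by (intro disjI2 bexI[of _ \<one>]) auto
    qed (use gen s_in_W in auto)
  next
    case (mult x y)
    then obtain x' y' where xy: "x' \<in> W T" "y' \<in> W T" "x = x' \<or> x = s t \<otimes> x'" "y = y' \<or> y = s t \<otimes> y'"
      by blast
    have c: "x' \<in> carrier G" "y' \<in> carrier G" using xy W_carrier TN(1) by auto
    have p: "x' \<otimes> y' \<in> W T" using xy sg by (simp add: subgroup.m_closed)
    have "x' \<otimes> (s t \<otimes> y') = s t \<otimes> (x' \<otimes> y')"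
      using c st comm'[OF xy(1)] by (simp add: m_assoc[symmetric])
    moreover have "s t \<otimes> x' \<otimes> (s t \<otimes> y') = x' \<otimes> y'"
    proof -
      have "s t \<otimes> x' \<otimes> (s t \<otimes> y') = s t \<otimes> (s t \<otimes> x') \<otimes> y'"
        using c st comm'[OF xy(1)] by (metis m_assoc m_closed)
      also have "s t \<otimes> (s t \<otimes> x') = x'" using c st s_sq[OF TN(2)] by (simp add: m_assoc[symmetric])
      finally show ?thesis .
    qed
    moreover have "s t \<otimes> x' \<otimes> y' = s t \<otimes> (x' \<otimes> y')" using c st by (simp add: m_assoc)
    ultimately show ?case using xy(3,4) p by auto
  qed
qed

text \<open>Generators are peeled off one by one: a product of \<open>s t\<close> with an element of
  W T has t in its support, so empty support puts x into the smaller subgroup.\<close>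

lemma supp_empty_imp_one:
  assumes "finite T" "T \<subseteq> {..<N}" "\<And>i j. i \<in> T \<Longrightarrow> j \<in> T \<Longrightarrow> i \<noteq> j \<Longrightarrow> m i j = 2"
    and "x \<in> W T" "supp x = {}"
  shows "x = \<one>"
  using assms
proof (induction T arbitrary: x)
  case empty
  then show ?case by (simp add: special_subgroup_def generate_empty)
next
  case (insert t T)
  have TN: "T \<subseteq> {..<N}" "t < N" using insert.prems by auto
  have "x \<in> W T \<or> (\<exists>y\<in>W T. x = s t \<otimes> y)"
    using insert.prems insert.hyps by (intro W_insert) (auto intro!: s_commute)
  moreover have "x \<noteq> s t \<otimes> y" if y: "y \<in> W T" for y
    using supp_W[OF TN(1) y] W_carrier[OF TN(1) y] insert.hyps insert.prems(4) s_closed[OF TN(2)]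
      supp_s[OF TN(2)] by (auto simp: supp_mult)
  ultimately have "x \<in> W T" by blast
  then show ?case using insert.IH insert.prems by auto
qed

lemma W_supp_surj:
  assumes "finite V" "V \<subseteq> T" "T \<subseteq> {..<N}"
  shows "\<exists>x\<in>W T. supp x = V"
  using assms
proof (induction V)
  case empty
  then show ?case using supp_one subgroup.one_closed[OF W_subgroup] by (intro bexI[of _ \<one>])
next
  case (insert i V)
  then obtain x where x: "x \<in> W T" "supp x = V" by auto
  have "s i \<otimes> x \<in> W T" using x insert.prems W_subgroup s_in_W by (auto simp: subgroup.m_closed)
  moreover have "supp (s i \<otimes> x) = insert i V"
    using x insert W_carrier[of T x] s_closed[of i] supp_s[of i] by (auto simp: supp_mult subset_iff)
  ultimately show ?case by blast
qed

section \<open>Spherical subsets\<close>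

lemma spherical_subset: "spherical G N s T \<Longrightarrow> U \<subseteq> T \<Longrightarrow> spherical G N s U"
  using W_mono[of U T] finite_subset by (auto simp: spherical_def)

lemma spherical_finite: "spherical G N s T \<Longrightarrow> finite T"
  by (auto simp: spherical_def intro: finite_subset)

lemma finite_sphericals: "finite {T. spherical G N s T}"
  by (rule finite_subset[of _ "Pow {..<N}"]) (auto simp: spherical_def)

lemma W_elementary_abelian:
  assumes sph: "spherical G N s T"
  shows "elementary_abelian_subgroup G (W T) supp T"
proof (intro elementary_abelian_subgroup.intro elementary_abelian_subgroup_axioms.intro is_group)
  have T: "T \<subseteq> {..<N}" "finite T" using sph spherical_finite by (auto simp: spherical_def)
  show sg: "subgroup (W T) G" by (rule W_subgroup[OF T(1)])
  show "finite T" by fact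
  show "supp (x \<otimes> y) = sym_diff (supp x) (supp y)" if "x \<in> W T" "y \<in> W T" for x y
    using that W_carrier[OF T(1)] by (simp add: supp_mult)
  show "bij_betw supp (W T) (Pow T)"
    unfolding bij_betw_def
  proof
    show "inj_on supp (W T)"
    proof (rule inj_onI)
      fix x y assume xy: "x \<in> W T" "y \<in> W T" "supp x = supp y"
      have c: "x \<in> carrier G" "y \<in> carrier G" using xy W_carrier[OF T(1)] by auto
      have "x \<otimes> inv y \<in> W T" using xy sg by (simp add: subgroup.m_closed subgroup.m_inv_closed)
      moreover have "supp (x \<otimes> inv y) = {}" using xy c by (simp add: supp_mult supp_inv)
      ultimately have "x \<otimes> inv y = \<one>"
        using supp_empty_imp_one[OF T(2,1)] spherical_imp_pairwise_commute[OF sph] by blast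
      then show "x = y" using c by (metis inv_equality inv_inv inv_closed)
    qed
    show "supp ` W T = Pow T"
    proof (intro equalityI subsetI)
      fix V assume "V \<in> Pow T"
      then have V: "V \<subseteq> T" "finite V" using T(2) finite_subset by auto
      obtain x where "x \<in> W T" "supp x = V" using W_supp_surj[OF V(2,1) T(1)] by (rule bexE)
      then show "V \<in> supp ` W T" by auto
    qed (use supp_W[OF T(1)] in auto)
  qed
qed

subsection \<open>Cells of the Davis complex\<close>

abbreviation S :: "nat set set" where
  "S \<equiv> {T. spherical G N s T}"

text \<open>The type \<open>T\<close> of a coset \<open>w W\<^sub>T\<close>, in a form that is visibly invariant under left translation.\<close>

definition ty :: "'a set \<Rightarrow> nat set" where
  "ty c = (\<Union>x\<in>c. \<Union>y\<in>c. sym_diff (supp x) (supp y))"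

section \<open>Cosets and their types\<close>

lemma spherical_N: "spherical G N s T \<Longrightarrow> T \<subseteq> {..<N}"
  by (simp add: spherical_def)

lemma W_subset_carrier: "spherical G N s T \<Longrightarrow> W T \<subseteq> carrier G"
  using subgroup.subset[OF W_subgroup[OF spherical_N]] .

lemma one_in_W: "spherical G N s T \<Longrightarrow> \<one> \<in> W T"
  using subgroup.one_closed[OF W_subgroup[OF spherical_N]] .

lemma l_coset_cancel:
  assumes "g \<in> carrier G" "c \<subseteq> carrier G" "c' \<subseteq> carrier G" "g <# c = g <# c'"
  shows "c = c'"
proof -
  have "inv g <# (g <# c) = inv g <# (g <# c')" using assms(4) by simp
  then show ?thesis using assms(1-3) by (simp add: lcos_m_assoc lcos_mult_one)
qed

lemma vertexE:
  assumes "c \<in> davis_vertices G N s"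
  obtains w T where "w \<in> carrier G" "spherical G N s T" "c = w <# W T"
  using assms by (auto simp: davis_vertices_def)

lemma coset_in_vertices:
  "w \<in> carrier G \<Longrightarrow> spherical G N s T \<Longrightarrow> w <# W T \<in> davis_vertices G N s"
  by (auto simp: davis_vertices_def)

lemma W_in_vertices: "spherical G N s T \<Longrightarrow> W T \<in> davis_vertices G N s"
  using coset_in_vertices[of \<one> T] by (simp add: lcos_mult_one W_subset_carrier)

lemma vertex_carrier: "c \<in> davis_vertices G N s \<Longrightarrow> c \<subseteq> carrier G"
  by (erule vertexE) (simp add: l_coset_subset_G W_subset_carrier)

lemma vertex_act:
  assumes "c \<in> davis_vertices G N s" "g \<in> carrier G"
  shows "g <# c \<in> davis_vertices G N s"
  using assms(1)
proof (rule vertexE)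
  fix w T assume "w \<in> carrier G" "spherical G N s T" "c = w <# W T"
  then show ?thesis
    using assms(2) by (simp add: lcos_m_assoc W_subset_carrier coset_in_vertices)
qed

lemma coset_self: "w \<in> carrier G \<Longrightarrow> spherical G N s T \<Longrightarrow> w \<in> w <# W T"
  using one_in_W[of T] r_one[of w] unfolding l_coset_def by force

lemma vertex_nonempty: "c \<in> davis_vertices G N s \<Longrightarrow> c \<noteq> {}"
  by (erule vertexE) (use coset_self in auto)

lemma ty_act:
  assumes "g \<in> carrier G" "c \<subseteq> carrier G"
  shows "ty (g <# c) = ty c"
proof -
  have "sym_diff (supp (g \<otimes> x)) (supp (g \<otimes> y)) = sym_diff (supp x) (supp y)"
    if "x \<in> c" "y \<in> c" for x y
  proof -
    have "x \<in> carrier G" "y \<in> carrier G" using that assms by auto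
    then show ?thesis using assms(1) by (auto simp: supp_mult)
  qed
  then show ?thesis unfolding ty_def l_coset_def by simp
qed

lemma ty_W:
  assumes T: "spherical G N s T"
  shows "ty (W T) = T"
proof
  show "ty (W T) \<subseteq> T"
    using supp_W[OF spherical_N[OF T]] by (fastforce simp: ty_def)
  show "T \<subseteq> ty (W T)"
  proof
    fix i assume i: "i \<in> T"
    have "i < N" using i spherical_N[OF T] by auto
    then have "i \<in> sym_diff (supp (s i)) (supp \<one>)" by (simp add: supp_s supp_one)
    then show "i \<in> ty (W T)"
      unfolding ty_def using s_in_W[OF i] one_in_W[OF T] by blast
  qed
qed

lemma ty_coset: "w \<in> carrier G \<Longrightarrow> spherical G N s T \<Longrightarrow> ty (w <# W T) = T"
  by (simp add: ty_act W_subset_carrier ty_W)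

lemma spherical_ty: "c \<in> davis_vertices G N s \<Longrightarrow> spherical G N s (ty c)"
  by (erule vertexE) (simp add: ty_coset)

text \<open>Any point of a coset can serve as its base point, so cosets with a common point are
  compared by type alone.\<close>

lemma vertex_eq_coset:
  assumes "c \<in> davis_vertices G N s" "w \<in> c"
  shows "c = w <# W (ty c)"
  using assms(1)
proof (rule vertexE)
  fix u T assume u: "u \<in> carrier G" "spherical G N s T" "c = u <# W T"
  then have "u <# W T = w <# W T"
    using assms(2) by (intro l_repr_independence W_subgroup spherical_N) auto
  moreover have "ty c = T" using u by (simp add: ty_coset)
  ultimately show ?thesis using u(3) by simp
qed

lemma ty_strict_mono:
  assumes "c \<in> davis_vertices G N s" "c' \<in> davis_vertices G N s" "c \<subset> c'"
  shows "ty c \<subset> ty c'"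
proof -
  obtain w where w: "w \<in> c" using vertex_nonempty[OF assms(1)] by auto
  have "ty c \<subseteq> ty c'" using assms(3) by (fastforce simp: ty_def)
  moreover have "ty c \<noteq> ty c'"
    using vertex_eq_coset[OF assms(1) w] vertex_eq_coset[OF assms(2), of w] w assms(3) by auto
  ultimately show ?thesis by auto
qed

lemma W_strict_mono:
  assumes "spherical G N s T" "spherical G N s T'" "T \<subset> T'"
  shows "W T \<subset> W T'"
proof -
  have "W T \<noteq> W T'"
  proof
    assume "W T = W T'"
    then have "ty (W T) = ty (W T')" by (rule arg_cong)
    then show False using assms(3) by (simp add: ty_W[OF assms(1)] ty_W[OF assms(2)])
  qed
  then show ?thesis using W_mono[of T T'] assms(3) by auto
qed

lemma l_coset_strict_mono:
  assumes "g \<in> carrier G" "c' \<subseteq> carrier G" "c \<subset> c'"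
  shows "g <# c \<subset> g <# c'"
proof -
  have "g <# c \<noteq> g <# c'" using l_coset_cancel[of g c c'] assms by auto
  moreover have "g <# c \<subseteq> g <# c'" using assms(3) by (auto simp: l_coset_def)
  ultimately show ?thesis by auto
qed

section \<open>Cells as translates of flags\<close>

lemma davis_cells_eq: "davis_cells G N s d = flags (davis_vertices G N s) (Suc d)"
  by (simp add: davis_cells_def flags_def)

lemma types_in_flags: "\<sigma> \<in> davis_cells G N s d \<Longrightarrow> map ty \<sigma> \<in> flags S (Suc d)"
  unfolding davis_cells_eq by (erule map_in_flags) (simp_all add: spherical_ty ty_strict_mono)

lemma std_in_cells: "F \<in> flags S (Suc d) \<Longrightarrow> map W F \<in> davis_cells G N s d"
  unfolding davis_cells_eq by (erule map_in_flags) (simp_all add: W_in_vertices W_strict_mono)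

lemma act_in_cells: "\<sigma> \<in> davis_cells G N s d \<Longrightarrow> g \<in> carrier G \<Longrightarrow> cell_act G g \<sigma> \<in> davis_cells G N s d"
  unfolding davis_cells_eq cell_act_def
  by (erule map_in_flags) (simp_all add: vertex_act vertex_carrier l_coset_strict_mono)

lemma cell_vertices: "\<sigma> \<in> davis_cells G N s d \<Longrightarrow> c \<in> set \<sigma> \<Longrightarrow> c \<in> davis_vertices G N s"
  by (auto simp: davis_cells_def)

lemma cell_carrier: "\<sigma> \<in> davis_cells G N s d \<Longrightarrow> c \<in> set \<sigma> \<Longrightarrow> c \<subseteq> carrier G"
  by (rule vertex_carrier[OF cell_vertices])

lemma cell_nonempty: "\<sigma> \<in> davis_cells G N s d \<Longrightarrow> \<sigma> \<noteq> []"
  by (auto simp: davis_cells_def)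

lemma types_std: "F \<in> flags S n \<Longrightarrow> map ty (map W F) = F"
  by (rule map_idI[of F "ty \<circ> W", unfolded map_map[symmetric]]) (auto simp: flags_def ty_W)

lemma types_act: "\<sigma> \<in> davis_cells G N s d \<Longrightarrow> g \<in> carrier G \<Longrightarrow> map ty (cell_act G g \<sigma>) = map ty \<sigma>"
  using cell_carrier[of \<sigma> d] by (auto simp: cell_act_def ty_act)

lemma cell_act_act:
  assumes "\<sigma> \<in> davis_cells G N s d" "g \<in> carrier G" "h \<in> carrier G"
  shows "cell_act G g (cell_act G h \<sigma>) = cell_act G (g \<otimes> h) \<sigma>"
  using cell_carrier[OF assms(1)] assms(2,3) by (auto simp: cell_act_def lcos_m_assoc)

lemma cell_act_one: "\<sigma> \<in> davis_cells G N s d \<Longrightarrow> cell_act G \<one> \<sigma> = \<sigma>"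
  using cell_carrier[of \<sigma> d] by (auto simp: cell_act_def lcos_mult_one intro!: map_idI)

lemma hd_subset_cell:
  assumes "\<sigma> \<in> davis_cells G N s d" "c \<in> set \<sigma>"
  shows "hd \<sigma> \<subseteq> c"
  using assms by (cases \<sigma>) (auto simp: davis_cells_def)

lemma cell_point:
  assumes "\<sigma> \<in> davis_cells G N s d"
  obtains w where "w \<in> hd \<sigma>" "w \<in> carrier G"
proof -
  have "hd \<sigma> \<in> set \<sigma>" using cell_nonempty[OF assms] by simp
  then have "hd \<sigma> \<noteq> {}" "hd \<sigma> \<subseteq> carrier G"
    by (simp_all add: vertex_nonempty[OF cell_vertices[OF assms]] cell_carrier[OF assms])
  then show ?thesis using that by auto
qed

text \<open>The least coset lies in all the others, so w is a common base point and one translation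
  moves the whole standard flag onto the cell.\<close>

lemma cell_eq_act_std:
  assumes \<sigma>: "\<sigma> \<in> davis_cells G N s d" and w: "w \<in> hd \<sigma>"
  shows "\<sigma> = cell_act G w (map W (map ty \<sigma>))"
proof -
  have "w <# W (ty c) = c" if c: "c \<in> set \<sigma>" for c
    by (rule vertex_eq_coset[OF cell_vertices[OF \<sigma> c] subsetD[OF hd_subset_cell[OF \<sigma> c] w], symmetric])
  then show ?thesis by (simp add: cell_act_def map_idI)
qed

lemma cell_orbit_act:
  assumes \<sigma>: "\<sigma> \<in> davis_cells G N s d" and g: "g \<in> carrier G"
  shows "cell_orbit G (cell_act G g \<sigma>) = cell_orbit G \<sigma>"
proof
  show "cell_orbit G (cell_act G g \<sigma>) \<subseteq> cell_orbit G \<sigma>"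
    using g by (auto simp: cell_orbit_def cell_act_act[OF \<sigma>])
  show "cell_orbit G \<sigma> \<subseteq> cell_orbit G (cell_act G g \<sigma>)"
  proof
    fix \<tau> assume "\<tau> \<in> cell_orbit G \<sigma>"
    then obtain h where h: "h \<in> carrier G" "\<tau> = cell_act G h \<sigma>" by (auto simp: cell_orbit_def)
    then have "\<tau> = cell_act G (h \<otimes> inv g) (cell_act G g \<sigma>)"
      using g by (simp add: cell_act_act[OF \<sigma>] m_assoc)
    then show "\<tau> \<in> cell_orbit G (cell_act G g \<sigma>)" using h g by (auto simp: cell_orbit_def)
  qed
qed

lemma cell_orbit_std:
  assumes \<sigma>: "\<sigma> \<in> davis_cells G N s d"
  shows "cell_orbit G \<sigma> = cell_orbit G (map W (map ty \<sigma>))"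
proof -
  obtain w where w: "w \<in> hd \<sigma>" "w \<in> carrier G" using cell_point[OF \<sigma>] .
  have "cell_orbit G \<sigma> = cell_orbit G (cell_act G w (map W (map ty \<sigma>)))"
    by (rule arg_cong[OF cell_eq_act_std[OF \<sigma> w(1)]])
  also have "\<dots> = cell_orbit G (map W (map ty \<sigma>))"
    by (rule cell_orbit_act[OF std_in_cells[OF types_in_flags[OF \<sigma>]] w(2)])
  finally show ?thesis .
qed

lemma self_in_cell_orbit: "\<sigma> \<in> davis_cells G N s d \<Longrightarrow> \<sigma> \<in> cell_orbit G \<sigma>"
  using cell_act_one unfolding cell_orbit_def by force

text \<open>Translation preserves types, and cells with equal types are translates of the same
  standard flag. Hence orbits of cells correspond to flags of spherical sets.\<close>

lemma in_cell_orbit_iff: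
  assumes \<sigma>: "\<sigma> \<in> davis_cells G N s d" and \<tau>: "\<tau> \<in> davis_cells G N s d"
  shows "\<tau> \<in> cell_orbit G \<sigma> \<longleftrightarrow> map ty \<tau> = map ty \<sigma>"
proof
  assume "\<tau> \<in> cell_orbit G \<sigma>"
  then show "map ty \<tau> = map ty \<sigma>" using types_act[OF \<sigma>] by (auto simp: cell_orbit_def)
next
  assume "map ty \<tau> = map ty \<sigma>"
  then have "cell_orbit G \<sigma> = cell_orbit G \<tau>"
    by (simp only: cell_orbit_std[OF \<sigma>] cell_orbit_std[OF \<tau>])
  then show "\<tau> \<in> cell_orbit G \<sigma>" using self_in_cell_orbit[OF \<tau>] by simp
qed

text \<open>The choice made in \<open>cell_reps\<close>, evaluated on the orbit of a standard flag.
  All that is known of the chosen cell is its orbit, hence its list of types.\<close>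

definition rep :: "nat set list \<Rightarrow> 'a set list" where
  "rep F = (SOME \<tau>. \<tau> \<in> cell_orbit G (map W F))"

lemma rep_in_orbit:
  assumes F: "F \<in> flags S (Suc d)"
  shows "rep F \<in> cell_orbit G (map W F)"
  unfolding rep_def by (rule someI) (rule self_in_cell_orbit[OF std_in_cells[OF F]])

lemma rep_in_cells:
  assumes F: "F \<in> flags S (Suc d)"
  shows "rep F \<in> davis_cells G N s d"
proof -
  obtain g where "g \<in> carrier G" "rep F = cell_act G g (map W F)"
    using rep_in_orbit[OF F] by (auto simp: cell_orbit_def)
  then show ?thesis using act_in_cells[OF std_in_cells[OF F]] by simp
qed

lemma types_rep:
  assumes F: "F \<in> flags S (Suc d)"
  shows "map ty (rep F) = F"
  using in_cell_orbit_iff[OF std_in_cells[OF F] rep_in_cells[OF F]] rep_in_orbit[OF F] types_std[OF F]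
  by simp

lemma cell_reps_eq: "cell_reps G N s d = rep ` flags S (Suc d)"
proof
  show "cell_reps G N s d \<subseteq> rep ` flags S (Suc d)"
  proof
    fix \<tau> assume "\<tau> \<in> cell_reps G N s d"
    then obtain \<sigma> where \<sigma>: "\<sigma> \<in> davis_cells G N s d" "\<tau> = (SOME \<tau>. \<tau> \<in> cell_orbit G \<sigma>)"
      by (auto simp: cell_reps_def)
    then have "\<tau> = rep (map ty \<sigma>)" by (simp only: rep_def cell_orbit_std[OF \<sigma>(1), symmetric])
    then show "\<tau> \<in> rep ` flags S (Suc d)" using types_in_flags[OF \<sigma>(1)] by simp
  qed
  show "rep ` flags S (Suc d) \<subseteq> cell_reps G N s d"
  proof
    fix \<tau> assume "\<tau> \<in> rep ` flags S (Suc d)"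
    then obtain F where F: "F \<in> flags S (Suc d)" "\<tau> = rep F" by auto
    then show "\<tau> \<in> cell_reps G N s d"
      using std_in_cells[OF F(1)] unfolding cell_reps_def rep_def by auto
  qed
qed

lemma inj_on_rep: "inj_on rep (flags S (Suc d))"
  by (rule inj_on_inverseI[of _ "map ty"]) (rule types_rep)

lemma cell_reps_in_cells: "\<sigma> \<in> cell_reps G N s d \<Longrightarrow> \<sigma> \<in> davis_cells G N s d"
  using rep_in_cells by (auto simp: cell_reps_eq)

lemma face_in_cells:
  "\<sigma> \<in> davis_cells G N s (Suc d) \<Longrightarrow> j \<le> Suc d \<Longrightarrow> cell_face j \<sigma> \<in> davis_cells G N s d"
  unfolding davis_cells_eq by (rule cell_face_in_flags)

text \<open>These conjugates are the elements that preserve the least coset. They move w within it,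
  hence within every larger coset of the cell, and so fix those too.\<close>

lemma cell_stab_eq_conj:
  assumes \<sigma>: "\<sigma> \<in> davis_cells G N s d" and w: "w \<in> hd \<sigma>" "w \<in> carrier G"
  shows "cell_stab G \<sigma> = (\<lambda>x. w \<otimes> x \<otimes> inv w) ` W (hd (map ty \<sigma>))"
proof -
  have hd\<sigma>: "hd \<sigma> \<in> set \<sigma>" and T: "hd (map ty \<sigma>) = ty (hd \<sigma>)"
    using cell_nonempty[OF \<sigma>] by (simp_all add: hd_map)
  have hdc: "hd \<sigma> = w <# W (ty (hd \<sigma>))"
    by (rule vertex_eq_coset[OF cell_vertices[OF \<sigma> hd\<sigma>] w(1)])
  have Wc: "W (ty (hd \<sigma>)) \<subseteq> carrier G"
    by (intro W_subset_carrier spherical_ty cell_vertices[OF \<sigma> hd\<sigma>])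
  show ?thesis unfolding T
  proof
    show "cell_stab G \<sigma> \<subseteq> (\<lambda>x. w \<otimes> x \<otimes> inv w) ` W (ty (hd \<sigma>))"
    proof
      fix g assume "g \<in> cell_stab G \<sigma>"
      then have g: "g \<in> carrier G" "map (\<lambda>c. g <# c) \<sigma> = \<sigma>" by (auto simp: cell_stab_def cell_act_def)
      have "hd (map (\<lambda>c. g <# c) \<sigma>) = g <# hd \<sigma>" using cell_nonempty[OF \<sigma>] by (simp add: hd_map)
      then have "g <# hd \<sigma> = hd \<sigma>" using g(2) by simp
      then have "g \<otimes> w \<in> hd \<sigma>" using w(1) by (auto simp: l_coset_def)
      then have "g \<otimes> w \<in> w <# W (ty (hd \<sigma>))" by (simp add: hdc[symmetric])
      then obtain x where x: "x \<in> W (ty (hd \<sigma>))" "g \<otimes> w = w \<otimes> x" by (auto simp: l_coset_def)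
      then have "g = w \<otimes> x \<otimes> inv w"
        using g(1) w(2) Wc by (metis inv_solve_right m_closed subsetD)
      then show "g \<in> (\<lambda>x. w \<otimes> x \<otimes> inv w) ` W (ty (hd \<sigma>))" using x(1) by auto
    qed
    show "(\<lambda>x. w \<otimes> x \<otimes> inv w) ` W (ty (hd \<sigma>)) \<subseteq> cell_stab G \<sigma>"
    proof
      fix g assume "g \<in> (\<lambda>x. w \<otimes> x \<otimes> inv w) ` W (ty (hd \<sigma>))"
      then obtain x where x: "x \<in> W (ty (hd \<sigma>))" "g = w \<otimes> x \<otimes> inv w" by auto
      have xc: "x \<in> carrier G" using x Wc by auto
      have gc: "g \<in> carrier G" using x xc w(2) by simp
      have gw: "g \<otimes> w = w \<otimes> x" using x(2) xc w(2) by (simp add: m_assoc)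
      have "g \<otimes> w \<in> w <# W (ty (hd \<sigma>))" unfolding gw l_coset_def using x(1) by auto
      then have gwh: "g \<otimes> w \<in> hd \<sigma>" by (simp add: hdc[symmetric])
      have "g <# c = c" if c: "c \<in> set \<sigma>" for c
      proof -
        note v = cell_vertices[OF \<sigma> c]
        have wc: "w \<in> c" "g \<otimes> w \<in> c" using hd_subset_cell[OF \<sigma> c] w(1) gwh by auto
        have "g <# c = g <# (w <# W (ty c))" by (simp add: vertex_eq_coset[OF v wc(1), symmetric])
        also have "\<dots> = (g \<otimes> w) <# W (ty c)"
          using gc w(2) W_subset_carrier[OF spherical_ty[OF v]] by (simp add: lcos_m_assoc)
        also have "\<dots> = c" by (simp add: vertex_eq_coset[OF v wc(2), symmetric])
        finally show ?thesis .
      qed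
      then show "g \<in> cell_stab G \<sigma>" using gc by (auto simp: cell_stab_def cell_act_def intro!: map_idI)
    qed
  qed
qed

lemma subgroup_cell_stab:
  assumes \<sigma>: "\<sigma> \<in> davis_cells G N s d"
  shows "subgroup (cell_stab G \<sigma>) G"
proof (rule subgroupI)
  show "cell_stab G \<sigma> \<subseteq> carrier G" by (auto simp: cell_stab_def)
  show "cell_stab G \<sigma> \<noteq> {}" using cell_act_one[OF \<sigma>] by (auto simp: cell_stab_def)
  fix g assume "g \<in> cell_stab G \<sigma>"
  then have g: "g \<in> carrier G" "cell_act G g \<sigma> = \<sigma>" by (auto simp: cell_stab_def)
  have "cell_act G (inv g) \<sigma> = cell_act G (inv g) (cell_act G g \<sigma>)" using g by simp
  also have "\<dots> = \<sigma>" using g(1) by (simp add: cell_act_act[OF \<sigma>] cell_act_one[OF \<sigma>])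
  finally show "inv g \<in> cell_stab G \<sigma>" using g by (simp add: cell_stab_def)
  fix h assume "h \<in> cell_stab G \<sigma>"
  then have h: "h \<in> carrier G" "cell_act G h \<sigma> = \<sigma>" by (auto simp: cell_stab_def)
  show "g \<otimes> h \<in> cell_stab G \<sigma>"
    using g h cell_act_act[OF \<sigma> g(1) h(1)] by (simp add: cell_stab_def)
qed

text \<open>Conjugation does not change \<open>supp\<close>, so the coordinates of the special
  subgroup carry over to the stabilizer independently of w.\<close>

lemma cell_stab_elementary_abelian:
  assumes \<sigma>: "\<sigma> \<in> davis_cells G N s d"
  shows "elementary_abelian_subgroup G (cell_stab G \<sigma>) supp (hd (map ty \<sigma>))"
proof (intro elementary_abelian_subgroup.intro elementary_abelian_subgroup_axioms.intro is_group)
  let ?T = "hd (map ty \<sigma>)"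
  have hd\<sigma>: "hd \<sigma> \<in> set \<sigma>" and T: "?T = ty (hd \<sigma>)"
    using cell_nonempty[OF \<sigma>] by (simp_all add: hd_map)
  have sph: "spherical G N s ?T" unfolding T by (intro spherical_ty cell_vertices[OF \<sigma> hd\<sigma>])
  obtain w where w: "w \<in> hd \<sigma>" "w \<in> carrier G" using cell_point[OF \<sigma>] .
  interpret W: elementary_abelian_subgroup G "W ?T" supp ?T by (rule W_elementary_abelian[OF sph])
  show "subgroup (cell_stab G \<sigma>) G" by (rule subgroup_cell_stab[OF \<sigma>])
  show "finite ?T" by (rule spherical_finite[OF sph])
  show "supp (x \<otimes> y) = sym_diff (supp x) (supp y)" if "x \<in> cell_stab G \<sigma>" "y \<in> cell_stab G \<sigma>" for x y
    using that by (simp add: cell_stab_def supp_mult)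
  have conj: "supp (w \<otimes> x \<otimes> inv w) = supp x" if "x \<in> W ?T" for x
    using W.K_carrier[OF that] w(2) by (simp add: supp_conj)
  show "bij_betw supp (cell_stab G \<sigma>) (Pow ?T)"
    unfolding cell_stab_eq_conj[OF \<sigma> w] bij_betw_def
  proof
    show "inj_on supp ((\<lambda>x. w \<otimes> x \<otimes> inv w) ` W ?T)"
    proof (rule inj_onI, elim imageE)
      fix g h x y assume *: "supp g = supp h" "g = w \<otimes> x \<otimes> inv w" "x \<in> W ?T"
        "h = w \<otimes> y \<otimes> inv w" "y \<in> W ?T"
      then have "supp x = supp y" by (simp add: conj)
      then show "g = h" using * W.v_inject[of x y] by simp
    qed
    have "supp ` (\<lambda>x. w \<otimes> x \<otimes> inv w) ` W ?T = supp ` W ?T"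
      unfolding image_image by (intro image_cong refl conj)
    then show "supp ` (\<lambda>x. w \<otimes> x \<otimes> inv w) ` W ?T = Pow ?T"
      using W.bij by (simp add: bij_betw_def)
  qed
qed

text \<open>The stabilizer fixes a cell vertex by vertex, hence each face. Transported by g, this is
  the inclusion required for the map of orbits.\<close>

lemma cell_stab_face:
  assumes \<tau>: "\<tau> \<in> davis_cells G N s d" and g: "g \<in> carrier G" "cell_act G g \<tau> = cell_face j \<sigma>"
    and k: "k \<in> cell_stab G \<sigma>"
  shows "inv g \<otimes> k \<otimes> g \<in> cell_stab G \<tau>"
proof -
  have kc: "k \<in> carrier G" "cell_act G k \<sigma> = \<sigma>" using k by (auto simp: cell_stab_def)
  have "cell_act G k (cell_face j \<sigma>) = cell_face j (cell_act G k \<sigma>)"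
    by (simp add: cell_act_def cell_face_map)
  then have kg: "cell_act G (k \<otimes> g) \<tau> = cell_act G g \<tau>"
    using cell_act_act[OF \<tau> kc(1) g(1)] by (simp add: g(2) kc(2))
  have "cell_act G (inv g \<otimes> k \<otimes> g) \<tau> = cell_act G (inv g) (cell_act G (k \<otimes> g) \<tau>)"
    using kc g(1) by (simp add: cell_act_act[OF \<tau>] m_assoc)
  also have "\<dots> = \<tau>" using g(1) by (simp add: kg cell_act_act[OF \<tau>] cell_act_one[OF \<tau>])
  finally show ?thesis using kc g(1) by (simp add: cell_stab_def)
qed

text \<open>L is abelian, so the summand in the induction formula is constant: on the image of K the
  result is the index 2^|U - T| times the value, elsewhere 0. The coordinates \<open>supp\<close>
  remove g from the answer.\<close>

lemma bredon_map_eq: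
  assumes K: "elementary_abelian_subgroup G K supp T" and L: "elementary_abelian_subgroup G L supp U"
    and g: "g \<in> carrier G" and conj: "\<And>k. k \<in> K \<Longrightarrow> inv g \<otimes> k \<otimes> g \<in> L"
    and \<phi>: "\<And>k. k \<in> K \<Longrightarrow> \<phi> k = f (supp k)" and x: "x \<in> L"
  shows "bredon_map G g K L \<phi> x = (if supp x \<subseteq> T then 2 ^ card (U - T) * f (supp x) else 0)"
proof -
  interpret K: elementary_abelian_subgroup G K supp T by fact
  interpret L: elementary_abelian_subgroup G L supp U by fact
  define H where "H = (\<lambda>k. inv g \<otimes> k \<otimes> g) ` K"
  have xc: "x \<in> carrier G" using L.K_carrier[OF x] .
  \<comment> \<open>Some element of K has support T and keeps it when conjugated into L.\<close>
  have TU: "T \<subseteq> U"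
  proof -
    obtain k where k: "k \<in> K" "supp k = T" using K.bij unfolding bij_betw_def by (auto dest: equalityD2)
    then have "supp (inv g \<otimes> k \<otimes> g) = T" using K.K_carrier g by (simp add: supp_conj')
    then show ?thesis using L.v_subset[OF conj[OF k(1)]] by simp
  qed
  have inj: "inj_on (\<lambda>k. inv g \<otimes> k \<otimes> g) K"
  proof (rule inj_onI)
    fix k l assume "k \<in> K" "l \<in> K" "inv g \<otimes> k \<otimes> g = inv g \<otimes> l \<otimes> g"
    then have "supp k = supp l" using supp_conj'[OF g K.K_carrier] by metis
    then show "k = l" using K.v_inject \<open>k \<in> K\<close> \<open>l \<in> K\<close> by simp
  qed
  have cardH: "card H = 2 ^ card T" unfolding H_def card_image[OF inj] by (rule K.card_K)
  have xH: "x \<in> H \<longleftrightarrow> supp x \<subseteq> T"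
  proof
    assume "x \<in> H"
    then obtain k where k: "k \<in> K" "x = inv g \<otimes> k \<otimes> g" by (auto simp: H_def)
    then show "supp x \<subseteq> T" using K.v_subset[OF k(1)] K.K_carrier[OF k(1)] g by (simp add: supp_conj')
  next
    assume "supp x \<subseteq> T"
    then have "supp x \<in> supp ` K" using K.bij unfolding bij_betw_def by simp
    then obtain k where k: "k \<in> K" "supp k = supp x" by auto
    then have "supp (inv g \<otimes> k \<otimes> g) = supp x" using K.K_carrier g by (simp add: supp_conj')
    then have "inv g \<otimes> k \<otimes> g = x" using L.v_inject[OF conj[OF k(1)] x] by simp
    then show "x \<in> H" using k(1) by (auto simp: H_def)
  qed
  have \<phi>x: "\<phi> (g \<otimes> x \<otimes> inv g) = f (supp x)" if xin: "x \<in> H"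
  proof -
    obtain k where k: "k \<in> K" "x = inv g \<otimes> k \<otimes> g" using xin by (auto simp: H_def)
    have kc: "k \<in> carrier G" using K.K_carrier[OF k(1)] .
    have "g \<otimes> (inv g \<otimes> k) = k" using kc g by (simp add: m_assoc[symmetric])
    then have "g \<otimes> x \<otimes> inv g = k" using kc g by (simp add: k(2) m_assoc)
    then show ?thesis using \<phi>[OF k(1)] kc g k(2) by (simp add: supp_conj')
  qed
  have yx: "inv y \<otimes> x \<otimes> y = x" if y: "y \<in> L" for y
  proof -
    have yc: "y \<in> carrier G" using L.K_carrier[OF y] .
    have "inv y \<otimes> x \<otimes> y = inv y \<otimes> (y \<otimes> x)"
      using xc yc by (simp add: m_assoc L.mult_commute_K[OF x y])
    also have "\<dots> = x" using xc yc by (simp add: m_assoc[symmetric])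
    finally show ?thesis .
  qed
  have "bredon_map G g K L \<phi> x =
    (\<Sum>y\<in>L. if x \<in> H then f (supp x) else 0) / of_nat (card H)"
    unfolding bredon_map_def induce_def H_def[symmetric] using x \<phi>x
    by (auto simp: yx intro!: sum.cong)
  also have "\<dots> = (if supp x \<subseteq> T then 2 ^ card U / 2 ^ card T * f (supp x) else 0)"
    by (simp add: xH cardH L.card_K)
  also have "(2 ^ card U / 2 ^ card T :: complex) = 2 ^ card (U - T)"
    using card_mono[OF L.fin TU] TU K.fin by (simp add: card_Diff_subset power_diff)
  finally show ?thesis .
qed

lemma bredon_map_outside: "x \<notin> L \<Longrightarrow> bredon_map G g K L \<phi> x = 0"
  by (simp add: bredon_map_def induce_def)

subsection \<open>Bredon chains\<close>

text \<open>Identifies coefficient tables with Bredon chains; only types and \<open>supp\<close>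
  enter the values. The default 0 is the normal form that \<open>bredon_chains\<close> and
  \<open>rep_ring\<close> prescribe.\<close>

definition realize :: "nat \<Rightarrow> (nat set list \<Rightarrow> nat set \<Rightarrow> int) \<Rightarrow> 'a set list \<Rightarrow> 'a \<Rightarrow> complex" where
  "realize d a = (\<lambda>\<sigma> x. if \<sigma> \<in> cell_reps G N s d \<and> x \<in> cell_stab G \<sigma>
     then induced_comb (hd (map ty \<sigma>)) (a (map ty \<sigma>)) (supp x) else 0)"

lemma realize_in_chains: "realize d a \<in> bredon_chains G N s d"
  unfolding bredon_chains_def
proof (safe)
  fix \<sigma> assume \<sigma>: "\<sigma> \<in> cell_reps G N s d"
  interpret K: elementary_abelian_subgroup G "cell_stab G \<sigma>" supp "hd (map ty \<sigma>)"
    by (rule cell_stab_elementary_abelian[OF cell_reps_in_cells[OF \<sigma>]])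
  show "realize d a \<sigma> \<in> rep_ring G (cell_stab G \<sigma>)"
    unfolding K.rep_ring_iff
    by (intro conjI exI[of _ "a (map ty \<sigma>)"]) (simp_all add: realize_def \<sigma>)
qed (auto simp: realize_def)

lemma realize_surj:
  assumes c: "c \<in> bredon_chains G N s d"
  shows "c \<in> realize d ` flag_chains S (Suc d)"
proof -
  have "\<exists>a. \<forall>x\<in>cell_stab G \<sigma>. c \<sigma> x = induced_comb (hd (map ty \<sigma>)) a (supp x)"
    and out: "\<And>x. x \<notin> cell_stab G \<sigma> \<Longrightarrow> c \<sigma> x = 0" if \<sigma>: "\<sigma> \<in> cell_reps G N s d" for \<sigma>
  proof -
    interpret K: elementary_abelian_subgroup G "cell_stab G \<sigma>" supp "hd (map ty \<sigma>)"
      by (rule cell_stab_elementary_abelian[OF cell_reps_in_cells[OF \<sigma>]])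
    have "c \<sigma> \<in> rep_ring G (cell_stab G \<sigma>)" using c \<sigma> by (simp add: bredon_chains_def)
    then show "\<exists>a. \<forall>x\<in>cell_stab G \<sigma>. c \<sigma> x = induced_comb (hd (map ty \<sigma>)) a (supp x)"
      "\<And>x. x \<notin> cell_stab G \<sigma> \<Longrightarrow> c \<sigma> x = 0"
      by (simp_all add: K.rep_ring_iff)
  qed
  then obtain f where f: "\<And>\<sigma> x. \<sigma> \<in> cell_reps G N s d \<Longrightarrow> x \<in> cell_stab G \<sigma> \<Longrightarrow>
      c \<sigma> x = induced_comb (hd (map ty \<sigma>)) (f \<sigma>) (supp x)"
    by metis
  define a where "a = (\<lambda>F U. if F \<in> flags S (Suc d) \<and> U \<subseteq> hd F then f (rep F) U else 0)"
  have "realize d a \<sigma> x = c \<sigma> x" for \<sigma> x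
  proof (cases "\<sigma> \<in> cell_reps G N s d")
    case True
    then obtain F where F: "F \<in> flags S (Suc d)" "\<sigma> = rep F" by (auto simp: cell_reps_eq)
    have "induced_comb (hd F) (a F) (supp x) = induced_comb (hd F) (f \<sigma>) (supp x)"
      using F by (intro induced_comb_cong) (simp add: a_def)
    then show ?thesis using True F f[OF True, of x] out[OF True, of x] types_rep[OF F(1)]
      by (simp add: realize_def)
  next
    case False
    then show ?thesis using c by (simp add: realize_def bredon_chains_def)
  qed
  then have "c = realize d a" by (intro ext) simp
  moreover have "a \<in> flag_chains S (Suc d)" by (auto simp: flag_chains_def a_def)
  ultimately show ?thesis by (rule image_eqI)
qed

lemma chains_eq_realize: "bredon_chains G N s d = realize d ` flag_chains S (Suc d)"
  using realize_in_chains realize_surj by (auto simp: subset_iff)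

lemma realize_inject:
  assumes a: "a \<in> flag_chains S (Suc d)" and b: "b \<in> flag_chains S (Suc d)"
    and eq: "realize d a = realize d b"
  shows "a = b"
proof (intro ext)
  fix F U
  show "a F U = b F U"
  proof (cases "F \<in> flags S (Suc d) \<and> U \<subseteq> hd F")
    case True
    then have F: "F \<in> flags S (Suc d)" and U: "U \<subseteq> hd F" by auto
    have \<sigma>: "rep F \<in> cell_reps G N s d" using F by (simp add: cell_reps_eq)
    interpret K: elementary_abelian_subgroup G "cell_stab G (rep F)" supp "hd F"
      using cell_stab_elementary_abelian[OF rep_in_cells[OF F]] by (simp only: types_rep[OF F])
    show ?thesis
    proof (rule induced_comb_inject[OF K.fin _ U])
      fix V assume "V \<subseteq> hd F"
      then have "V \<in> supp ` cell_stab G (rep F)" using K.bij by (simp add: bij_betw_def)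
      then obtain x where x: "x \<in> cell_stab G (rep F)" "V = supp x" by auto
      then show "induced_comb (hd F) (a F) V = induced_comb (hd F) (b F) V"
        using fun_cong[OF fun_cong[OF eq, of "rep F"], of x] \<sigma> types_rep[OF F]
        by (simp add: realize_def)
    qed
  next
    case False
    then have "a F U = 0" "b F U = 0" using a b unfolding flag_chains_def by blast+
    then show ?thesis by simp
  qed
qed

lemma realize_add: "realize d (\<lambda>F U. a F U + b F U) = (\<lambda>\<sigma> x. realize d a \<sigma> x + realize d b \<sigma> x)"
  by (auto simp: realize_def induced_comb_add fun_eq_iff)

lemma realize_uminus: "realize d (\<lambda>F U. - a F U) = (\<lambda>\<sigma> x. - realize d a \<sigma> x)"
  by (auto simp: realize_def induced_comb_uminus fun_eq_iff)

lemma realize_zero: "realize d (\<lambda>F U. 0) = (\<lambda>\<sigma> x. 0)"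
  by (auto simp: realize_def induced_comb_zero fun_eq_iff)

text \<open>By \<open>bredon_map_eq\<close> each face contributes an explicit induced character, and
  by \<open>induced_comb_extend\<close> it has the coefficients of the original cell.\<close>

lemma realize_boundary:
  assumes a: "a \<in> flag_chains S (Suc (Suc d))"
  shows "bredon_boundary G N s d (realize (Suc d) a) = realize d (flag_boundary S (Suc (Suc d)) a)"
proof (intro ext)
  fix \<tau> x
  let ?\<delta> = "\<lambda>E H. of_bool (H = E) :: int"
  show "bredon_boundary G N s d (realize (Suc d) a) \<tau> x = realize d (flag_boundary S (Suc (Suc d)) a) \<tau> x"
  proof (cases "\<tau> \<in> cell_reps G N s d \<and> x \<in> cell_stab G \<tau>")
    case False
    then show ?thesis
      by (auto simp: bredon_boundary_def realize_def bredon_map_outside intro!: sum.neutral)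
  next
    case True
    then have \<tau>: "\<tau> \<in> cell_reps G N s d" and x: "x \<in> cell_stab G \<tau>" by auto
    note \<tau>c = cell_reps_in_cells[OF \<tau>]
    define E where "E = map ty \<tau>"
    have L: "elementary_abelian_subgroup G (cell_stab G \<tau>) supp (hd E)"
      unfolding E_def by (rule cell_stab_elementary_abelian[OF \<tau>c])
    have summand: "(if cell_face j (rep F) \<in> cell_orbit G \<tau> then (- 1) ^ j *
        bredon_map G (SOME g. g \<in> carrier G \<and> cell_act G g \<tau> = cell_face j (rep F))
          (cell_stab G (rep F)) (cell_stab G \<tau>) (realize (Suc d) a (rep F)) x else 0) =
      (- 1) ^ j * of_bool (cell_face j F = E) * induced_comb (hd E) (a F) (supp x)"
      if F: "F \<in> flags S (Suc (Suc d))" and j: "j \<le> Suc d" for F j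
    proof -
      let ?\<sigma> = "rep F"
      note \<sigma>c = rep_in_cells[OF F]
      have \<sigma>: "?\<sigma> \<in> cell_reps G N s (Suc d)" using F by (simp add: cell_reps_eq)
      have orb: "cell_face j ?\<sigma> \<in> cell_orbit G \<tau> \<longleftrightarrow> cell_face j F = E"
        using in_cell_orbit_iff[OF \<tau>c face_in_cells[OF \<sigma>c j]] types_rep[OF F]
        by (simp add: cell_face_map E_def)
      show ?thesis
      proof (cases "cell_face j F = E")
        case False
        then show ?thesis using orb by simp
      next
        case True
        \<comment> \<open>The chosen g enters only through its two defining properties.\<close>
        define g where "g = (SOME g. g \<in> carrier G \<and> cell_act G g \<tau> = cell_face j ?\<sigma>)"
        have "\<exists>g. g \<in> carrier G \<and> cell_act G g \<tau> = cell_face j ?\<sigma>"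
          using orb True by (auto simp: cell_orbit_def)
        then have g: "g \<in> carrier G" "cell_act G g \<tau> = cell_face j ?\<sigma>"
          unfolding g_def by (metis (mono_tags, lifting) someI_ex)+
        have K: "elementary_abelian_subgroup G (cell_stab G ?\<sigma>) supp (hd F)"
          using cell_stab_elementary_abelian[OF \<sigma>c] by (simp only: types_rep[OF F])
        have "bredon_map G g (cell_stab G ?\<sigma>) (cell_stab G \<tau>) (realize (Suc d) a ?\<sigma>) x =
          (if supp x \<subseteq> hd F then 2 ^ card (hd E - hd F) * induced_comb (hd F) (a F) (supp x) else 0)"
        proof (rule bredon_map_eq[OF K L g(1) _ _ x])
          show "inv g \<otimes> k \<otimes> g \<in> cell_stab G \<tau>" if "k \<in> cell_stab G ?\<sigma>" for k
            by (rule cell_stab_face[OF \<tau>c g that])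
          show "realize (Suc d) a ?\<sigma> k = induced_comb (hd F) (a F) (supp k)"
            if "k \<in> cell_stab G ?\<sigma>" for k
            using that \<sigma> types_rep[OF F] by (simp add: realize_def)
        qed
        also have "\<dots> = induced_comb (hd E) (a F) (supp x)"
        proof (rule induced_comb_extend)
          show "finite (hd E)" using elementary_abelian_subgroup.fin[OF L] .
          show "hd F \<subseteq> hd E" using hd_subset_hd_cell_face[OF F _ j] True by simp
          show "a F U = 0" if "\<not> U \<subseteq> hd F" for U using a that unfolding flag_chains_def by blast
        qed
        finally show ?thesis using orb True by (simp add: g_def)
      qed
    qed
    have "bredon_boundary G N s d (realize (Suc d) a) \<tau> x =
      (\<Sum>F\<in>flags S (Suc (Suc d)). \<Sum>j\<le>Suc d.
        (- 1) ^ j * of_bool (cell_face j F = E) * induced_comb (hd E) (a F) (supp x))"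
      unfolding bredon_boundary_def cell_reps_eq[of "Suc d"] sum.reindex[OF inj_on_rep]
      using \<tau> by (auto simp: summand intro!: sum.cong)
    also have "\<dots> = (\<Sum>F\<in>flags S (Suc (Suc d)).
        of_int (alt_face_sum (?\<delta> E) F) * induced_comb (hd E) (a F) (supp x))"
    proof (intro sum.cong refl)
      fix F assume "F \<in> flags S (Suc (Suc d))"
      then have "{..<length F} = {..Suc d}" by (auto simp: flags_def)
      then show "(\<Sum>j\<le>Suc d. (- 1) ^ j * of_bool (cell_face j F = E) * induced_comb (hd E) (a F) (supp x)) =
        of_int (alt_face_sum (?\<delta> E) F) * induced_comb (hd E) (a F) (supp x)"
        by (simp only: alt_face_sum_def of_int_sum sum_distrib_right) (simp del: sum.atMost_Suc)
    qed
    also have "\<dots> = induced_comb (hd E) (flag_boundary S (Suc (Suc d)) a E) (supp x)"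
      unfolding flag_boundary_def by (rule induced_comb_sum[symmetric])
    also have "\<dots> = realize d (flag_boundary S (Suc (Suc d)) a) \<tau> x"
      using \<tau> x by (simp add: realize_def E_def)
    finally show ?thesis .
  qed
qed

text \<open>For i = 0 this says that the boundaries are the 0-chains of augmentation 0, by exactness
  at flags with one vertex.\<close>

lemma boundaries_eq_realize: "bredon_boundaries G N s i = realize i ` flag_cycles S (Suc i)"
proof -
  have "bredon_boundaries G N s i = realize i ` flag_boundary S (Suc (Suc i)) ` flag_chains S (Suc (Suc i))"
    unfolding bredon_boundaries_def chains_eq_realize image_image
    by (intro image_cong refl realize_boundary)
  also have "flag_boundary S (Suc (Suc i)) ` flag_chains S (Suc (Suc i)) = flag_cycles S (Suc i)"
  proof (rule flag_boundary_image[OF finite_sphericals])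
    show "U \<in> S" if "T \<in> S" "U \<subseteq> T" for T U using spherical_subset[of T U] that by simp
  qed simp
  finally show ?thesis .
qed

text \<open>Being injective and compatible with boundaries, \<open>realize\<close> reflects the
  cycle condition. In degree 0 the notions differ: every Bredon chain is a cycle, but
  \<open>flag_cycles\<close> demands augmentation 0.\<close>

lemma cycles_eq_realize:
  assumes "i \<noteq> 0"
  shows "bredon_cycles G N s i = realize i ` flag_cycles S (Suc i)"
proof -
  obtain d where i: "i = Suc d" using assms by (cases i) auto
  have *: "bredon_boundary G N s d (realize i a) = (\<lambda>_ _. 0) \<longleftrightarrow> flag_boundary S (Suc i) a = (\<lambda>_ _. 0)"
    if a: "a \<in> flag_chains S (Suc i)" for a
  proof -
    have fb: "flag_boundary S (Suc i) a \<in> flag_chains S (Suc d)"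
      using a unfolding i by (rule flag_boundary_in_flag_chains) simp
    have zero: "(\<lambda>_ _. 0) \<in> flag_chains S (Suc d)"
      using additively_closed_flag_chains[of S "Suc d"] by (simp add: additively_closed_def)
    have eq: "bredon_boundary G N s d (realize i a) = realize d (flag_boundary S (Suc i) a)"
      using realize_boundary a by (simp add: i)
    show ?thesis
    proof
      assume "bredon_boundary G N s d (realize i a) = (\<lambda>_ _. 0)"
      then have "realize d (flag_boundary S (Suc i) a) = realize d (\<lambda>_ _. 0)"
        by (simp only: eq realize_zero)
      then show "flag_boundary S (Suc i) a = (\<lambda>_ _. 0)" by (rule realize_inject[OF fb zero])
    qed (simp only: eq realize_zero)
  qed
  have "bredon_cycles G N s i = {c \<in> realize i ` flag_chains S (Suc i). bredon_boundary G N s d c = (\<lambda>_ _. 0)}"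
    by (simp add: bredon_cycles_def chains_eq_realize i)
  also have "\<dots> = realize i ` flag_cycles S (Suc i)"
    using * by (auto simp: flag_cycles_def)
  finally show ?thesis .
qed

section \<open>Homology groups\<close>

lemma group_realize:
  assumes B: "additively_closed B"
  shows "group (bredon_chain_group G N s d\<lparr>carrier := realize d ` B\<rparr>)"
proof (rule groupI)
  fix c assume "c \<in> carrier (bredon_chain_group G N s d\<lparr>carrier := realize d ` B\<rparr>)"
  then obtain b where b: "b \<in> B" "c = realize d b" by auto
  then have "realize d (\<lambda>F U. - b F U) \<in> realize d ` B" using B by (simp add: additively_closed_def)
  then show "\<exists>y\<in>carrier (bredon_chain_group G N s d\<lparr>carrier := realize d ` B\<rparr>).
      y \<otimes>\<^bsub>bredon_chain_group G N s d\<lparr>carrier := realize d ` B\<rparr>\<^esub> c =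
      \<one>\<^bsub>bredon_chain_group G N s d\<lparr>carrier := realize d ` B\<rparr>\<^esub>"
    using b by (intro bexI[of _ "realize d (\<lambda>F U. - b F U)"])
      (simp_all add: bredon_chain_group_def realize_uminus)
next
  fix c c' assume "c \<in> carrier (bredon_chain_group G N s d\<lparr>carrier := realize d ` B\<rparr>)"
    "c' \<in> carrier (bredon_chain_group G N s d\<lparr>carrier := realize d ` B\<rparr>)"
  then obtain b b' where b: "b \<in> B" "c = realize d b" "b' \<in> B" "c' = realize d b'" by auto
  then have "realize d (\<lambda>F U. b F U + b' F U) \<in> realize d ` B" using B by (simp add: additively_closed_def)
  then show "c \<otimes>\<^bsub>bredon_chain_group G N s d\<lparr>carrier := realize d ` B\<rparr>\<^esub> c' \<in>
      carrier (bredon_chain_group G N s d\<lparr>carrier := realize d ` B\<rparr>)"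
    using b by (simp add: bredon_chain_group_def realize_add)
next
  have "realize d (\<lambda>F U. 0) \<in> realize d ` B" using B by (simp add: additively_closed_def)
  then show "\<one>\<^bsub>bredon_chain_group G N s d\<lparr>carrier := realize d ` B\<rparr>\<^esub> \<in>
      carrier (bredon_chain_group G N s d\<lparr>carrier := realize d ` B\<rparr>)"
    by (simp add: bredon_chain_group_def realize_zero)
qed (simp_all add: bredon_chain_group_def add.assoc)

lemma homology_trivial:
  assumes "i \<noteq> 0"
  shows "trivial_group (bredon_homology G N s i)"
proof -
  let ?Z = "bredon_chain_group G N s i\<lparr>carrier := bredon_cycles G N s i\<rparr>"
  have "group ?Z"
    unfolding cycles_eq_realize[OF assms] by (rule group_realize[OF additively_closed_flag_cycles])
  then have "trivial_group (?Z Mod carrier ?Z)" by (rule trivial_group_Mod_carrier)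
  then show ?thesis
    by (simp add: bredon_homology_def boundaries_eq_realize cycles_eq_realize[OF assms])
qed

lemma homology_zero:
  "bredon_homology G N s 0 \<cong> free_Abelian_group {..<card S}"
proof -
  let ?C = "bredon_chain_group G N s 0\<lparr>carrier := bredon_cycles G N s 0\<rparr>"
  let ?A = "free_Abelian_group {..<card S}"
  define A where "A = flag_chains S (Suc 0)"
  define coord where "coord = inv_into A (realize 0)"
  obtain e where e: "bij_betw e {..<card S} S"
    using ex_bij_betw_nat_finite[OF finite_sphericals] by (auto simp: lessThan_atLeast0)
  \<comment> \<open>The augmentation has one component for each spherical U; e numbers these sets,
    as the target is free on an initial segment of nat.\<close>
  define aug where "aug = (\<lambda>a :: nat set list \<Rightarrow> nat set \<Rightarrow> int.
    Abs_poly_mapping (\<lambda>k. if k < card S then \<Sum>T\<in>S. a [T] (e k) else 0))"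
  have fin_aug: "finite {k. (if k < card S then f k else 0) \<noteq> (0 :: int)}" for f :: "nat \<Rightarrow> int"
    by (rule finite_subset[of _ "{..<card S}"]) auto
  have "Poly_Mapping.lookup (aug a) = (\<lambda>k. if k < card S then \<Sum>T\<in>S. a [T] (e k) else 0)" for a
    unfolding aug_def by (rule lookup_Abs_poly_mapping) (rule fin_aug)
  then have lookup_aug: "Poly_Mapping.lookup (aug a) k = (if k < card S then \<Sum>T\<in>S. a [T] (e k) else 0)" for a k
    by (rule fun_cong)
  have carr: "carrier ?C = realize 0 ` A"
    by (simp add: bredon_cycles_def chains_eq_realize A_def)
  have coord: "coord (realize 0 a) = a" if "a \<in> A" for a
    unfolding coord_def
    by (rule inv_into_f_f[OF _ that]) (auto simp: A_def inj_on_def intro: realize_inject[of _ 0])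
  have gC: "group ?C"
  proof -
    have "bredon_cycles G N s 0 = realize 0 ` A" using carr by simp
    then show ?thesis by (simp only: A_def) (rule group_realize[OF additively_closed_flag_chains])
  qed
  have add_A: "(\<lambda>F U. a F U + b F U) \<in> A" if "a \<in> A" "b \<in> A" for a b
    using that additively_closed_flag_chains[of S "Suc 0"] by (simp add: additively_closed_def A_def)
  have "(\<lambda>c. aug (coord c)) \<in> hom ?C ?A"
  proof (rule homI)
    fix c assume "c \<in> carrier ?C"
    have "k < card S" if "k \<in> Poly_Mapping.keys (aug (coord c))" for k
      using that by (cases "k < card S") (simp_all only: in_keys_iff lookup_aug if_False simp_thms)
    then show "aug (coord c) \<in> carrier ?A"
      unfolding carrier_free_Abelian_group_iff by (intro subsetI) simp
  next
    fix c c' assume "c \<in> carrier ?C" "c' \<in> carrier ?C"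
    then obtain a b where ab: "a \<in> A" "c = realize 0 a" "b \<in> A" "c' = realize 0 b"
      unfolding carr by auto
    then have "c \<otimes>\<^bsub>?C\<^esub> c' = realize 0 (\<lambda>F U. a F U + b F U)"
      by (simp add: bredon_chain_group_def realize_add)
    moreover have "aug (\<lambda>F U. a F U + b F U) = aug a + aug b"
      by (rule poly_mapping_eqI) (simp add: lookup_aug lookup_add sum.distrib)
    ultimately show "aug (coord (c \<otimes>\<^bsub>?C\<^esub> c')) = aug (coord c) \<otimes>\<^bsub>?A\<^esub> aug (coord c')"
      using ab by (simp only: coord add_A mult_free_Abelian_group)
  qed
  then interpret h: group_hom ?C ?A "\<lambda>c. aug (coord c)"
    using gC by (simp add: group_hom_def group_hom_axioms_def)
  have "(\<lambda>c. aug (coord c)) ` carrier ?C = carrier ?A"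
  proof
    show "(\<lambda>c. aug (coord c)) ` carrier ?C \<subseteq> carrier ?A"
      by (intro image_subsetI h.hom_closed)
    show "carrier ?A \<subseteq> (\<lambda>c. aug (coord c)) ` carrier ?C"
    proof
      fix p assume "p \<in> carrier ?A"
      then have p: "Poly_Mapping.keys p \<subseteq> {..<card S}" by simp
      \<comment> \<open>A preimage of p puts the coefficient for U on the vertex U itself, the apex
        of its cone.\<close>
      define a :: "nat set list \<Rightarrow> nat set \<Rightarrow> int" where
        "a = (\<lambda>F U. if U \<in> S \<and> F = [U] then Poly_Mapping.lookup p (inv_into {..<card S} e U) else 0)"
      have aA: "a \<in> A" by (auto simp: a_def A_def flag_chains_def flags_def)
      have "aug a = p"
      proof (rule poly_mapping_eqI)
        fix k
        show "Poly_Mapping.lookup (aug a) k = Poly_Mapping.lookup p k"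
        proof (cases "k < card S")
          case True
          then have ek: "e k \<in> S" "inv_into {..<card S} e (e k) = k"
            using e by (auto simp: bij_betw_def inv_into_f_f)
          have "(\<Sum>T\<in>S. a [T] (e k)) = (\<Sum>T\<in>S. if T = e k then Poly_Mapping.lookup p k else 0)"
            using ek by (intro sum.cong refl) (auto simp: a_def)
          also have "\<dots> = Poly_Mapping.lookup p k" using ek(1) finite_sphericals by simp
          finally show ?thesis using True by (simp add: lookup_aug)
        next
          case False
          then have "k \<notin> Poly_Mapping.keys p" using p by auto
          then show ?thesis using False by (simp add: lookup_aug in_keys_iff)
        qed
      qed
      then have "p = aug (coord (realize 0 a))" using coord[OF aA] by simp
      moreover have "realize 0 a \<in> carrier ?C" unfolding carr using aA by (rule imageI)
      ultimately show "p \<in> (\<lambda>c. aug (coord c)) ` carrier ?C" by (rule image_eqI)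
    qed
  qed
  then have "(?C Mod kernel ?C ?A (\<lambda>c. aug (coord c))) \<cong> ?A" by (rule h.FactGroup_iso)
  moreover have "kernel ?C ?A (\<lambda>c. aug (coord c)) = bredon_boundaries G N s 0"
  proof -
    have ker: "aug a = 0 \<longleftrightarrow> flag_boundary S (Suc 0) a = (\<lambda>_ _. 0)" if a: "a \<in> A" for a
    proof
      assume "aug a = 0"
      then have z: "(\<Sum>T\<in>S. a [T] (e k)) = 0" if "k < card S" for k
        using lookup_aug[of a k] that by simp
      show "flag_boundary S (Suc 0) a = (\<lambda>_ _. 0)"
      proof (intro ext)
        fix F U
        have "(\<Sum>T\<in>S. a [T] U) = 0"
        proof (cases "U \<in> S")
          case True
          then have "U \<in> e ` {..<card S}" using e by (simp only: bij_betw_def)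
          then obtain k where "k < card S" "e k = U" by auto
          then show ?thesis using z[of k] by simp
        next
          case False
          \<comment> \<open>A nonspherical U lies in no spherical set and so carries no coefficient;
            the components at spherical sets determine the whole augmentation.\<close>
          have "a [T] U = 0" if "T \<in> S" for T
          proof (rule ccontr)
            assume "a [T] U \<noteq> 0"
            then have "U \<subseteq> hd [T]" using a unfolding A_def flag_chains_def by blast
            then show False using that False spherical_subset[of T U] by simp
          qed
          then show ?thesis by (intro sum.neutral) auto
        qed
        then show "flag_boundary S (Suc 0) a F U = 0" by (simp add: flag_boundary_one)
      qed
    next
      assume "flag_boundary S (Suc 0) a = (\<lambda>_ _. 0)"
      then have "(\<Sum>T\<in>S. a [T] U) = 0" for U
        using flag_boundary_one[of S a "[]" U] by simp
      then show "aug a = 0" by (intro poly_mapping_eqI) (simp add: lookup_aug)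
    qed
    have "kernel ?C ?A (\<lambda>c. aug (coord c)) = {c \<in> realize 0 ` A. aug (coord c) = 0}"
      by (simp only: kernel_def carr one_free_Abelian_group)
    also have "\<dots> = realize 0 ` {a \<in> A. aug a = 0}" by (auto simp: coord)
    also have "{a \<in> A. aug a = 0} = flag_cycles S (Suc 0)"
      using ker by (auto simp: flag_cycles_def A_def)
    finally show ?thesis by (simp add: boundaries_eq_realize)
  qed
  ultimately show ?thesis by (simp add: bredon_homology_def)
qed

end

theorem theorem7p1:
  fixes G :: "('g, 'b) monoid_scheme" and N :: nat and m :: "nat \<Rightarrow> nat \<Rightarrow> enat"
    and s :: "nat \<Rightarrow> 'g"
  assumes "coxeter_system G N m s"
    and "right_angled N m"
  shows "bredon_homology G N s 0 \<cong> free_Abelian_group {..<card {T. spherical G N s T}} \<and>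
         (\<forall>i. i \<noteq> 0 \<longrightarrow> trivial_group (bredon_homology G N s i))"
proof -
  have "group G" using assms(1) by (simp add: coxeter_system_def)
  then interpret right_angled_coxeter G N m s
    using assms by (intro right_angled_coxeter.intro right_angled_coxeter_axioms.intro)
  show ?thesis using homology_zero homology_trivial by simp
qed

end
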